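(* Let $t \ge 1$ and $s \ge 2$ be fixed integers such that $r_{t-1}(3) \le s < r_t(3)$. Then, as $n \to \infty$, $$f_{\alpha_s; K_3,\ldots,K_3}(n) = n^{1/2+o(1)},$$ where $K_3$ appears exactly $t$ times in the subscript. Furthermore, as $n\to\infty$, $$f_{\alpha_3; K_3, K_3}(n) = n^{1/2+o(1)}, \quad f_{\alpha_4; K_3, K_3}(n) = n^{1/2+o(1)}, \quad f_{\alpha_5; K_3, K_3}(n) = n^{1/2+o(1)},$$ $$\Omega(n^{5/11}) \le f_{\alpha_5; K_3, K_3, K_3}(n) \le n^{1/2+o(1)},$$ $$\Omega(n^{20/61}) \le f_{\alpha_5; K_3, K_3, K_3, K_3}(n) \le n^{1/3+o(1)}.$$
   Context: For a graph $G$, the $s$-independence number $\alpha_s(G)$ is the maximum size of a vertex subset that induces no copy of $K_s$. For integers $i_1,\ldots,i_t$, a graph $G$ is $(K_{i_1},\ldots,K_{i_t})$-free if there is a coloring of $E(G)$ with $t$ colors such that, for every $1 \le j \le t$, the edges of the $j$-th color contain no copy of $K_{i_j}$. The multicolor Erdős–Rogers function is $$f_{\alpha_s; K_{i_1},\ldots,K_{i_t}}(n) = \min\{\alpha_s(G) : G \text{ is a } (K_{i_1},\ldots,K_{i_t})\text{-free graph with } n \text{ vertices}\}.$$ The multicolor Ramsey number $r_t(3)$ is the smallest integer $m$ such that every coloring of $E(K_m)$ with $t$ colors contains a monochromatic triangle; with zero colors, $r_0(3)=2$ (since $K_2$ has an edge that cannot be colored). *)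

theory Defs
  imports Complex_Main "HOL-Library.Ramsey" "HOL-Library.Landau_Symbols"
begin

text \<open>
  A finite simple graph is given by a vertex set \<open>V\<close> and an edge set \<open>E \<subseteq> [V]\<^bsup>2\<^esup>\<close>.
  The constant \<^const>\<open>clique\<close> is the one of \<^theory>\<open>HOL-Library.Ramsey\<close>.
\<close>

definition K_free :: "nat \<Rightarrow> 'a set \<Rightarrow> 'a set set \<Rightarrow> bool" where
  "K_free k U E \<longleftrightarrow> \<not> (\<exists>H \<in> [U]\<^bsup>k\<^esup>. clique H E)"

definition s_independence_number :: "nat \<Rightarrow> 'a set \<Rightarrow> 'a set set \<Rightarrow> nat" where
  "s_independence_number s V E = Max {card U | U. U \<subseteq> V \<and> K_free s U E}"

text \<open>The list \<open>ks\<close> is \<open>[i\<^sub>1, \<dots>, i\<^sub>t]\<close>; the colours are the positions \<open>0, \<dots>, t - 1\<close> in it.\<close>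

definition multicolour_K_free :: "nat list \<Rightarrow> 'a set \<Rightarrow> 'a set set \<Rightarrow> bool" where
  "multicolour_K_free ks V E \<longleftrightarrow>
     (\<exists>c \<in> E \<rightarrow> {..<length ks}. \<forall>j < length ks. K_free (ks ! j) V {e \<in> E. c e = j})"

text \<open>
  The minimum is over graphs with vertex set \<open>{0, \<dots>, n - 1}\<close>; since all notions involved are
  invariant under isomorphism, this is the minimum over all graphs with \<open>n\<close> vertices.
\<close>

definition erdos_rogers :: "nat \<Rightarrow> nat list \<Rightarrow> nat \<Rightarrow> nat" where
  "erdos_rogers s ks n =
     Min {s_independence_number s {..<n} E | E. E \<subseteq> [{..<n}]\<^bsup>2\<^esup> \<and> multicolour_K_free ks {..<n} E}"

text \<open>
  For \<open>t = 0\<close> this yields \<open>2\<close>: the complete graphs on \<open>0\<close> and \<open>1\<close> vertices have the empty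
  colouring, which has no monochromatic triangle, and \<open>K\<^sub>2\<close> has no colouring with \<open>0\<close> colours.
\<close>

definition ramsey_triangle :: "nat \<Rightarrow> nat" where
  "ramsey_triangle t = (LEAST m. partn_lst {..<m} (replicate t 3) 2)"

text \<open>The class of functions \<open>n\<^bsup>a + o(1)\<^esup>\<close> as \<open>n \<rightarrow> \<infinity>\<close>.\<close>

definition power_o1 :: "real \<Rightarrow> (nat \<Rightarrow> real) set" where
  "power_o1 a =
     {g. \<exists>\<epsilon> \<in> o(\<lambda>_. 1). eventually (\<lambda>n. g n = real n powr (a + \<epsilon> n)) sequentially}"

end

theory Submission
  imports Defs "HOL-Real_Asymp.Real_Asymp"
begin

text \<open>
  \<^bold>\<open>Lower bounds.\<close> Let \<open>m\<close> be the maximal size of a \<open>K\<^sub>s\<close>-free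
  set. The colour-\<open>j\<close> neighbourhood of a vertex uses only the other \<open>t - 1\<close> colours, so it
  is \<open>K\<^sub>s\<close>-free if \<open>s\<close> is at least the multicolour Ramsey number for \<open>t -
  1\<close> colours; hence all degrees are at most \<open>t m\<close> and a greedy independent set gives \<open>n
  \<le> (t + 1) m\<^sup>2\<close>. For \<open>s = 5\<close> and more colours one counts copies of
  \<open>K\<^sub>5\<close>: repeatedly removing a vertex that sees two different colours shows that a
  \<open>K\<^sub>5\<close> is built from an edge by three extensions, each inside the intersection of two
  neighbourhoods of different colours. Such an intersection has lost two colours and so has at most \<open>m\<close>
  (three colours) or \<open>O(m\<^sup>2)\<close> (four colours) vertices. A random vertex partition then yields a
  large set without \<open>K\<^sub>5\<close>. With three colours this is done on the vertices all of whose colour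
  degrees are at most \<open>m\<^bsup>9/5\<^esup>\<close>. If instead colour \<open>i\<close> has degree above
  \<open>m\<^bsup>9/5\<^esup>\<close> on a large set of vertices, then there are few edges of other colours at that
  set, and one destroys all triangles with two edges outside colour \<open>i\<close>; what remains is
  \<open>K\<^sub>5\<close>-free.

  \<^bold>\<open>Upper bounds.\<close> For \<open>s < r\<^sub>t(3)\<close> fix a colouring of \<open>K\<^sub>s\<close>
  without monochromatic triangle. Take points \<open>(u, v)\<close> with \<open>u\<close> on a paraboloid over a grid,
  and blocks on which \<open>v - i u\<close> is constant, for slopes \<open>i < r\<close> where \<open>r\<close> is
  \<open>n\<^bsup>o(1)\<^esup>\<close>. By strict convexity no three blocks form a triangle. Replacing each block by a
  random blow-up of the coloured \<open>K\<^sub>s\<close> gives no monochromatic triangle, and a union bound shows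
  that every set of \<open>n\<^bsup>1/2+o(1)\<^esup>\<close> points contains a \<open>K\<^sub>s\<close>. For \<open>2
  t\<close> colours one pulls a \<open>t\<close>-coloured graph on \<open>N = n\<^bsup>2/3\<^esup>\<close> vertices
  back along the two components of a random map from the \<open>n\<close> vertices to pairs: a
  \<open>K\<^sub>s\<close>-free set is mapped into a product \<open>Y \<times> Z\<close> with \<open>|Y|, |Z| \<le>
  N\<^bsup>1/2+o(1)\<^esup>\<close>, hence has at most \<open>n\<^bsup>1/3+o(1)\<^esup>\<close> elements.
\<close>

subsection \<open>Triangle-free colourings and square-root lower bounds\<close>

text \<open>The palette is a set \<open>J\<close>, so that a single colour can be deleted from it,
  and only pairs inside \<open>V\<close> are constrained, so that \<open>E\<close> and
  \<open>c\<close> stay fixed while \<open>V\<close> shrinks.\<close>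

definition triangle_colouring :: "nat set \<Rightarrow> 'a set \<Rightarrow> 'a set set \<Rightarrow> ('a set \<Rightarrow> nat) \<Rightarrow> bool" where
  "triangle_colouring J V E c \<longleftrightarrow>
     (\<forall>x\<in>V. \<forall>y\<in>V. x \<noteq> y \<longrightarrow> {x, y} \<in> E \<longrightarrow> c {x, y} \<in> J) \<and>
     (\<forall>j. K_free 3 V {e \<in> E. c e = j})"

definition K_free_bound :: "nat \<Rightarrow> 'a set \<Rightarrow> 'a set set \<Rightarrow> nat \<Rightarrow> bool" where
  "K_free_bound s V E m \<longleftrightarrow> (\<forall>X\<subseteq>V. K_free s X E \<longrightarrow> card X \<le> m)"

definition colour_nbhd :: "'a set set \<Rightarrow> ('a set \<Rightarrow> nat) \<Rightarrow> nat \<Rightarrow> 'a \<Rightarrow> 'a set" where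
  "colour_nbhd E c j v = {w. w \<noteq> v \<and> {v, w} \<in> E \<and> c {v, w} = j}"

lemma K_free_boundI:
  "(\<And>X. X \<subseteq> V \<Longrightarrow> K_free s X E \<Longrightarrow> card X \<le> m) \<Longrightarrow> K_free_bound s V E m"
  unfolding K_free_bound_def by blast

lemma K_free_boundD: "K_free_bound s V E m \<Longrightarrow> X \<subseteq> V \<Longrightarrow> K_free s X E \<Longrightarrow> card X \<le> m"
  unfolding K_free_bound_def by blast

lemma K_free_bound_subset: "K_free_bound s V E m \<Longrightarrow> U \<subseteq> V \<Longrightarrow> K_free_bound s U E m"
  unfolding K_free_bound_def by (blast intro: subset_trans)

lemma K_free_subset: "K_free s V E \<Longrightarrow> U \<subseteq> V \<Longrightarrow> K_free s U E"
  unfolding K_free_def using nsets_mono by blast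

lemma K_free_3_iff:
  "K_free 3 V E \<longleftrightarrow>
     (\<forall>x\<in>V. \<forall>y\<in>V - {x}. \<forall>z\<in>V - {x, y}. \<not> ({x, y} \<in> E \<and> {y, z} \<in> E \<and> {x, z} \<in> E))"
proof -
  have "clique {x, y, z} E \<longleftrightarrow> {x, y} \<in> E \<and> {y, z} \<in> E \<and> {x, z} \<in> E"
    if "x \<noteq> y" "y \<noteq> z" "x \<noteq> z" for x y z
    using that insert_commute[of x y "{}"] insert_commute[of y z "{}"] insert_commute[of x z "{}"]
    unfolding clique_def by auto
  then have *: "(\<exists>H\<in>[V]\<^bsup>3\<^esup>. clique H E) \<longleftrightarrow>
      (\<exists>x\<in>V. \<exists>y\<in>V - {x}. \<exists>z\<in>V - {x, y}. {x, y} \<in> E \<and> {y, z} \<in> E \<and> {x, z} \<in> E)"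
    unfolding nsets_3_eq bex_UN by (intro bex_cong refl) auto
  show ?thesis
    unfolding K_free_def * by blast
qed

lemma triangle_colouring_subset:
  "triangle_colouring J V E c \<Longrightarrow> U \<subseteq> V \<Longrightarrow> triangle_colouring J U E c"
  unfolding triangle_colouring_def by (blast intro: K_free_subset)

lemma triangle_colouring_mem:
  "triangle_colouring J V E c \<Longrightarrow> x \<in> V \<Longrightarrow> y \<in> V \<Longrightarrow> x \<noteq> y \<Longrightarrow> {x, y} \<in> E \<Longrightarrow> c {x, y} \<in> J"
  unfolding triangle_colouring_def by blast

lemma triangle_colouring_no_triangle:
  assumes "triangle_colouring J V E c" "x \<in> V" "y \<in> V" "z \<in> V" "x \<noteq> y" "y \<noteq> z" "x \<noteq> z"
    "{x, y} \<in> E" "{y, z} \<in> E" "{x, z} \<in> E" "c {x, y} = j" "c {y, z} = j" "c {x, z} = j"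
  shows False
proof -
  have "K_free 3 V {e \<in> E. c e = j}"
    using assms(1) unfolding triangle_colouring_def by blast
  then show False
    unfolding K_free_3_iff mem_Collect_eq
    using assms(2-) by (elim ballE[of _ _ x] ballE[of _ _ y] ballE[of _ _ z]) simp_all
qed

lemma triangle_colouringI:
  assumes "\<And>x y. x \<in> V \<Longrightarrow> y \<in> V \<Longrightarrow> x \<noteq> y \<Longrightarrow> {x, y} \<in> E \<Longrightarrow> c {x, y} \<in> J"
    and "\<And>x y z j. x \<in> V \<Longrightarrow> y \<in> V \<Longrightarrow> z \<in> V \<Longrightarrow> x \<noteq> y \<Longrightarrow> y \<noteq> z \<Longrightarrow> x \<noteq> z \<Longrightarrow>
      {x, y} \<in> E \<Longrightarrow> {y, z} \<in> E \<Longrightarrow> {x, z} \<in> E \<Longrightarrow> c {x, y} = j \<Longrightarrow> c {y, z} = j \<Longrightarrow> c {x, z} = j \<Longrightarrow> False"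
  shows "triangle_colouring J V E c"
  unfolding triangle_colouring_def K_free_3_iff mem_Collect_eq
  by (intro conjI allI ballI impI notI, fact assms(1), elim conjE DiffE, rule assms(2), assumption+) auto

text \<open>An edge of colour \<open>j\<close> between two \<open>j\<close>-neighbours of
  \<open>v\<close> would close a monochromatic triangle with \<open>v\<close>. This loss of a colour
  drives all the lower bounds.\<close>

lemma triangle_colouring_colour_nbhd:
  assumes "triangle_colouring J V E c" "v \<in> V"
  shows "triangle_colouring (J - {j}) (V \<inter> colour_nbhd E c j v) E c"
proof (rule triangle_colouringI)
  fix x y assume xy: "x \<in> V \<inter> colour_nbhd E c j v" "y \<in> V \<inter> colour_nbhd E c j v" "x \<noteq> y" "{x, y} \<in> E"
  then have "c {x, y} \<noteq> j"
    using triangle_colouring_no_triangle[OF assms(1), of v x y j] assms(2)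
    unfolding colour_nbhd_def by blast
  then show "c {x, y} \<in> J - {j}"
    using triangle_colouring_mem[OF assms(1)] xy by blast
next
  show False if "x \<in> V \<inter> colour_nbhd E c j v" "y \<in> V \<inter> colour_nbhd E c j v" "z \<in> V \<inter> colour_nbhd E c j v"
    "x \<noteq> y" "y \<noteq> z" "x \<noteq> z" "{x, y} \<in> E" "{y, z} \<in> E" "{x, z} \<in> E" "c {x, y} = i" "c {y, z} = i" "c {x, z} = i"
    for x y z i
    using triangle_colouring_no_triangle[OF assms(1) _ _ _ that(4-)] that(1-3) by blast
qed

text \<open>A colour outside the palette has an empty class, so quantifying over all colours agrees
  with quantifying over \<open>j < t\<close>; since \<open>E\<close> consists of pairs from
  \<open>V\<close>, every edge is covered by the palette condition.\<close>

lemma multicolour_K_free_triangle_iff: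
  assumes "E \<subseteq> [V]\<^bsup>2\<^esup>"
  shows "multicolour_K_free (replicate t 3) V E \<longleftrightarrow> (\<exists>c. triangle_colouring {..<t} V E c)"
proof -
  have "c \<in> E \<rightarrow> {..<t} \<and> (\<forall>j<t. K_free 3 V {e \<in> E. c e = j}) \<longleftrightarrow> triangle_colouring {..<t} V E c" for c
  proof
    assume c: "c \<in> E \<rightarrow> {..<t} \<and> (\<forall>j<t. K_free 3 V {e \<in> E. c e = j})"
    then have "K_free 3 V {e \<in> E. c e = j}" for j
    proof (cases "j < t")
      case False
      with c have "{e \<in> E. c e = j} = {}" by auto
      then show ?thesis by (simp add: K_free_3_iff)
    qed (use c in auto)
    with c show "triangle_colouring {..<t} V E c"
      unfolding triangle_colouring_def by auto
  next
    assume c: "triangle_colouring {..<t} V E c"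
    have "c e \<in> {..<t}" if "e \<in> E" for e
      using subsetD[OF assms that] that triangle_colouring_mem[OF c] by (elim nsets2_E) auto
    with c show "c \<in> E \<rightarrow> {..<t} \<and> (\<forall>j<t. K_free 3 V {e \<in> E. c e = j})"
      unfolding triangle_colouring_def by simp
  qed
  then show ?thesis
    unfolding multicolour_K_free_def by (simp add: Bex_def)
qed

section \<open>Multicolour Ramsey numbers of triangles\<close>

lemma ramsey_triangle_partn: "partn_lst {..<ramsey_triangle t} (replicate t 3) 2"
  unfolding ramsey_triangle_def
  by (rule LeastI_ex[where P = "\<lambda>m. partn_lst {..<m} (replicate t 3) 2", OF ramsey_full])

lemma partn_lst_ramsey_triangle_iff:
  "partn_lst {..<m} (replicate t 3) 2 \<longleftrightarrow> ramsey_triangle t \<le> m"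
proof
  show "ramsey_triangle t \<le> m" if "partn_lst {..<m} (replicate t 3) 2"
    using that unfolding ramsey_triangle_def
    by (rule Least_le[where P = "\<lambda>m. partn_lst {..<m} (replicate t 3) 2"])
qed (rule partn_lst_greater_resource[OF ramsey_triangle_partn])

lemma ex_triangle_colouring_iff:
  fixes m :: nat
  shows "(\<exists>c. triangle_colouring {..<t} {..<m} ([{..<m}]\<^bsup>2\<^esup>) c) \<longleftrightarrow> m < ramsey_triangle t"
proof -
  \<comment> \<open>A monochromatic 3-set in the partition sense is exactly a triangle inside one
    colour class.\<close>
  have *: "monochromatic {..<m} 3 2 c i \<longleftrightarrow> \<not> K_free 3 {..<m} {e \<in> [{..<m}]\<^bsup>2\<^esup>. c e = i}" for c i
  proof -
    have "c ` [H]\<^bsup>2\<^esup> \<subseteq> {i} \<longleftrightarrow> clique H {e \<in> [{..<m}]\<^bsup>2\<^esup>. c e = i}" if "H \<in> [{..<m}]\<^bsup>3\<^esup>" for H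
    proof -
      have sub: "H \<subseteq> {..<m}" using that by (simp add: nsets_def)
      have "c ` [H]\<^bsup>2\<^esup> \<subseteq> {i} \<longleftrightarrow> (\<forall>v\<in>H. \<forall>w\<in>H - {v}. c {v, w} = i)"
        unfolding nsets_2_eq image_UN UN_subset_iff by simp
      also have "\<dots> \<longleftrightarrow> (\<forall>v\<in>H. \<forall>w\<in>H. v \<noteq> w \<longrightarrow> c {v, w} = i)"
        by (simp add: Ball_def eq_commute imp_conjL)
      also have "\<dots> \<longleftrightarrow> clique H {e \<in> [{..<m}]\<^bsup>2\<^esup>. c e = i}"
        unfolding clique_def mem_Collect_eq doubleton_in_nsets_2
        using sub by (intro ball_cong refl) auto
      finally show ?thesis .
    qed
    then show ?thesis
      unfolding monochromatic_def K_free_def by (simp cong: bex_cong)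
  qed
  have "(\<exists>c. triangle_colouring {..<t} {..<m} ([{..<m}]\<^bsup>2\<^esup>) c) \<longleftrightarrow> multicolour_K_free (replicate t 3) {..<m} ([{..<m}]\<^bsup>2\<^esup>)"
    by (rule multicolour_K_free_triangle_iff[OF subset_refl, symmetric])
  also have "\<dots> \<longleftrightarrow> \<not> partn_lst {..<m} (replicate t 3) 2"
    unfolding multicolour_K_free_def partn_lst_def length_replicate Ball_def not_all not_imp Bex_def
    by (intro ex_cong1 conj_cong refl) (simp add: *)
  finally have "(\<exists>c. triangle_colouring {..<t} {..<m} ([{..<m}]\<^bsup>2\<^esup>) c) \<longleftrightarrow> \<not> partn_lst {..<m} (replicate t 3) 2" .
  then show ?thesis
    by (simp add: partn_lst_ramsey_triangle_iff not_le)
qed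

text \<open>Bijections of \<open>{..<s}\<close> with a clique \<open>H\<close> and of
  \<open>J\<close> with \<open>{..<card J}\<close> would carry the colouring to one of the complete
  graph on \<open>s\<close> vertices without monochromatic triangle, which the Ramsey number
  excludes.\<close>

lemma K_free_of_ramsey_triangle:
  assumes "triangle_colouring J V E c" "finite J" "ramsey_triangle (card J) \<le> s"
  shows "K_free s V E"
  unfolding K_free_def
proof clarify
  fix H assume H: "H \<in> [V]\<^bsup>s\<^esup>" "clique H E"
  then obtain g where g: "bij_betw g {..<s} H"
    by (metis (mono_tags, lifting) bij_betw_from_nat_into_finite mem_Collect_eq nsets_def)
  obtain b where b: "bij_betw b J {..<card J}"
    using \<open>finite J\<close> ex_bij_betw_finite_nat atLeast0LessThan by metis
  have gV: "g x \<in> V" if "x < s" for x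
    using bij_betwE[OF g] H(1) that by (auto simp: nsets_def)
  have ne: "g x \<noteq> g y" if "x < s" "y < s" "x \<noteq> y" for x y
    using bij_betw_imp_inj_on[OF g] that by (auto dest: inj_onD)
  have gE: "{g x, g y} \<in> E" if "x < s" "y < s" "x \<noteq> y" for x y
    using H(2) ne[OF that] bij_betwE[OF g] that unfolding clique_def by blast
  have cJ: "c {g x, g y} \<in> J" if "x < s" "y < s" "x \<noteq> y" for x y
    using triangle_colouring_mem[OF assms(1)] gV ne gE that by blast
  have "triangle_colouring {..<card J} {..<s} ([{..<s}]\<^bsup>2\<^esup>) (\<lambda>e. b (c (g ` e)))"
  proof (rule triangle_colouringI, unfold lessThan_iff image_insert image_empty)
    fix x y assume "x < s" "y < s" "x \<noteq> y"
    then show "b (c {g x, g y}) < card J" using cJ bij_betwE[OF b] by auto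
  next
    fix x y z j
    assume xyz: "x < s" "y < s" "z < s" "x \<noteq> y" "y \<noteq> z" "x \<noteq> z"
      and j: "b (c {g x, g y}) = j" "b (c {g y, g z}) = j" "b (c {g x, g z}) = j"
    note binj = inj_onD[OF bij_betw_imp_inj_on[OF b]]
    have "c {g y, g z} = c {g x, g y}" "c {g x, g z} = c {g x, g y}"
      by (rule binj[OF trans[OF j(2) j(1)[symmetric]] cJ[OF xyz(2,3,5)] cJ[OF xyz(1,2,4)]],
          rule binj[OF trans[OF j(3) j(1)[symmetric]] cJ[OF xyz(1,3,6)] cJ[OF xyz(1,2,4)]])
    from triangle_colouring_no_triangle[OF assms(1) gV[OF xyz(1)] gV[OF xyz(2)] gV[OF xyz(3)]
        ne[OF xyz(1,2,4)] ne[OF xyz(2,3,5)] ne[OF xyz(1,3,6)]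
        gE[OF xyz(1,2,4)] gE[OF xyz(2,3,5)] gE[OF xyz(1,3,6)] refl this]
    show False .
  qed
  then have "s < ramsey_triangle (card J)"
    by (intro iffD1[OF ex_triangle_colouring_iff] exI)
  with assms(3) show False by simp
qed

section \<open>Independent sets and the square-root lower bound\<close>

lemma K_free_mono:
  assumes "K_free s V E" "s \<le> s'"
  shows "K_free s' V E"
  unfolding K_free_def
proof clarify
  fix H assume H: "H \<in> [V]\<^bsup>s'\<^esup>" "clique H E"
  then obtain H' where "H' \<subseteq> H" "card H' = s" "finite H'"
    using assms(2) obtain_subset_with_card_n[of s H] by (auto simp: nsets_def)
  with H have "H' \<in> [V]\<^bsup>s\<^esup>" "clique H' E"
    by (auto simp: nsets_def intro: smaller_clique)
  then show False using assms(1) unfolding K_free_def by blast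
qed

lemma K_free_2_iff: "K_free 2 V E \<longleftrightarrow> (\<forall>x\<in>V. \<forall>y\<in>V. x \<noteq> y \<longrightarrow> {x, y} \<notin> E)"
  unfolding K_free_def nsets_2_eq clique_def by (auto simp: insert_commute)

text \<open>Choosing a vertex \<open>v\<close> and discarding it with its neighbours removes at most
  \<open>d + 1\<close> vertices and leaves only non-neighbours of \<open>v\<close>.\<close>

lemma greedy_independent_set:
  assumes "finite V" "\<And>v. v \<in> V \<Longrightarrow> card {w \<in> V. w \<noteq> v \<and> {v, w} \<in> E} \<le> d"
  shows "\<exists>I\<subseteq>V. K_free 2 I E \<and> card V \<le> (d + 1) * card I"
  using assms
proof (induction "card V" arbitrary: V rule: less_induct)
  case less
  show ?case
  proof (cases "V = {}")
    case True
    then show ?thesis by (auto simp: K_free_2_iff)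
  next
    case False
    then obtain v where v: "v \<in> V" by blast
    define N where "N = {w \<in> V. w \<noteq> v \<and> {v, w} \<in> E}"
    define V' where "V' = V - insert v N"
    have N: "N \<subseteq> V" "v \<notin> N" "card N \<le> d" using less.prems(2)[OF v] by (auto simp: N_def)
    have fin: "finite V'" "finite N" using \<open>finite V\<close> N finite_subset by (auto simp: V'_def)
    have card: "card V = card V' + (card N + 1)"
      using v N fin \<open>finite V\<close> unfolding V'_def
      by (subst card_Diff_subset) (auto simp: card_mono card.insert_remove intro: card_mono
          dest: card_mono[of V "insert v N"])
    have "card {w \<in> V'. w \<noteq> u \<and> {u, w} \<in> E} \<le> d" if "u \<in> V'" for u
      using less.prems(2)[of u] that \<open>finite V\<close>
      by (intro le_trans[OF card_mono less.prems(2)[of u]]) (auto simp: V'_def)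
    with less.hyps[of V'] fin card obtain I where I: "I \<subseteq> V'" "K_free 2 I E" "card V' \<le> (d + 1) * card I"
      by auto
    have "K_free 2 (insert v I) E"
      using I(1,2) v unfolding K_free_2_iff V'_def N_def by (auto simp: insert_commute)
    moreover have "card (insert v I) = card I + 1"
      using I(1) fin finite_subset[OF I(1)] by (subst card_insert_disjoint) (auto simp: V'_def)
    moreover have "insert v I \<subseteq> V" using I(1) v by (auto simp: V'_def)
    ultimately show ?thesis using card N(3) I(3)
      by (intro exI[of _ "insert v I"]) auto
  qed
qed

text \<open>The neighbourhood of a vertex is the union of its colour neighbourhoods, so all degrees
  are at most \<open>card J * d\<close>. The greedy independent set is \<open>K_s\<close>-free
  because \<open>s\<close> is at least 2, so it has at most \<open>m\<close> elements.\<close>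

lemma card_le_of_sparse_nbhds:
  assumes "triangle_colouring J V E c" "finite V" "finite J" "2 \<le> s"
    "K_free_bound s V E m" "\<And>v j. v \<in> V \<Longrightarrow> j \<in> J \<Longrightarrow> card (V \<inter> colour_nbhd E c j v) \<le> d"
  shows "card V \<le> (card J * d + 1) * m"
proof -
  have "card {w \<in> V. w \<noteq> v \<and> {v, w} \<in> E} \<le> card J * d" if v: "v \<in> V" for v
  proof -
    have "{w \<in> V. w \<noteq> v \<and> {v, w} \<in> E} \<subseteq> (\<Union>j\<in>J. V \<inter> colour_nbhd E c j v)"
      using triangle_colouring_mem[OF assms(1) v] unfolding colour_nbhd_def by blast
    then have "card {w \<in> V. w \<noteq> v \<and> {v, w} \<in> E} \<le> card (\<Union>j\<in>J. V \<inter> colour_nbhd E c j v)"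
      using assms(2,3) by (intro card_mono) auto
    also have "\<dots> \<le> (\<Sum>j\<in>J. card (V \<inter> colour_nbhd E c j v))"
      using assms(3) by (rule card_UN_le)
    also have "\<dots> \<le> card J * d"
      using assms(6)[OF v] sum_bounded_above[of J "\<lambda>j. card (V \<inter> colour_nbhd E c j v)" d] by simp
    finally show ?thesis .
  qed
  from greedy_independent_set[OF assms(2) this] obtain I
    where I: "I \<subseteq> V" "K_free 2 I E" "card V \<le> (card J * d + 1) * card I" by auto
  have "card I \<le> m"
    using I(1,2) assms(4,5) K_free_mono unfolding K_free_bound_def by blast
  then show ?thesis using I(3) by (meson le_trans mult_le_mono2)
qed

text \<open>A colour neighbourhood uses one colour less, so the Ramsey hypothesis makes it
  \<open>K_s\<close>-free and bounds its size by \<open>m\<close>.\<close>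

lemma sqrt_lower_bound:
  assumes "triangle_colouring J V E c" "finite V" "finite J" "2 \<le> s" "ramsey_triangle (card J - 1) \<le> s"
    "K_free_bound s V E m"
  shows "card V \<le> (card J + 1) * m\<^sup>2"
proof (cases "m = 0")
  case True
  \<comment> \<open>For \<open>m = 0\<close> the summand 1 cannot be absorbed into \<open>m\<close>,
    but the trivial degree bound \<open>card V\<close> already forces \<open>V\<close> to be
    empty.\<close>
  have "card V \<le> (card J * card V + 1) * m"
    using assms by (intro card_le_of_sparse_nbhds[OF assms(1-4,6)] card_mono) auto
  then show ?thesis using True by simp
next
  case False
  have "card V \<le> (card J * m + 1) * m"
  proof (intro card_le_of_sparse_nbhds[OF assms(1-4,6)])
    fix v j assume "v \<in> V" "j \<in> J"
    then have "K_free s (V \<inter> colour_nbhd E c j v) E"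
      using assms by (intro K_free_of_ramsey_triangle[OF triangle_colouring_colour_nbhd[OF assms(1)]]) auto
    then show "card (V \<inter> colour_nbhd E c j v) \<le> m"
      using assms(6) unfolding K_free_bound_def by blast
  qed
  also have "\<dots> \<le> (card J * m + m) * m"
    using False by (intro mult_le_mono1) auto
  also have "\<dots> = (card J + 1) * m\<^sup>2"
    by (simp add: power2_eq_square algebra_simps)
  finally show ?thesis .
qed

section \<open>The Erdos-Rogers function in terms of bounds on clique-free sets\<close>

lemma finite_K_free_sizes:
  assumes "finite V"
  shows "finite {card U |U. U \<subseteq> V \<and> K_free s U E}"
proof (rule finite_subset)
  show "{card U |U. U \<subseteq> V \<and> K_free s U E} \<subseteq> card ` Pow V" by blast
qed (use assms in simp)

lemma K_free_bound_s_independence_number: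
  assumes "finite V"
  shows "K_free_bound s V E (s_independence_number s V E)"
  unfolding K_free_bound_def s_independence_number_def
proof (intro allI impI Max_ge[OF finite_K_free_sizes[OF assms]])
  show "card X \<in> {card U |U. U \<subseteq> V \<and> K_free s U E}" if "X \<subseteq> V" "K_free s X E" for X
    using that by blast
qed

lemma s_independence_number_le:
  assumes "finite V" "K_free_bound s V E m" "s > 0"
  shows "s_independence_number s V E \<le> m"
  unfolding s_independence_number_def
proof (rule Max.boundedI[OF finite_K_free_sizes[OF assms(1)]])
  have "K_free s {} E" using \<open>s > 0\<close> by (simp add: K_free_def nsets_empty_iff)
  then show "{card U |U. U \<subseteq> V \<and> K_free s U E} \<noteq> {}" by blast
  show "a \<le> m" if "a \<in> {card U |U. U \<subseteq> V \<and> K_free s U E}" for a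
    using that assms(2) unfolding K_free_bound_def by (elim CollectE exE conjE) simp
qed

lemma finite_erdos_rogers_values:
  fixes n :: nat
  shows "finite {s_independence_number s {..<n} E | E. E \<subseteq> [{..<n}]\<^bsup>2\<^esup> \<and> multicolour_K_free ks {..<n} E}"
proof (rule finite_subset)
  show "{s_independence_number s {..<n} E | E. E \<subseteq> [{..<n}]\<^bsup>2\<^esup> \<and> multicolour_K_free ks {..<n} E}
    \<subseteq> s_independence_number s {..<n} ` Pow ([{..<n}]\<^bsup>2\<^esup>)" by blast
qed (intro finite_imageI finite_Pow_iff[THEN iffD2] finite_imp_finite_nsets finite_lessThan)

text \<open>The edgeless graph makes the set of values nonempty, so some graph attains the minimum.
  The lower bounds are proved for this extremal graph.\<close>

lemma erdos_rogers_attained: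
  "\<exists>E c. E \<subseteq> [{..<n}]\<^bsup>2\<^esup> \<and> triangle_colouring {..<t} {..<n} E c \<and>
     K_free_bound s {..<n} E (erdos_rogers s (replicate t 3) n)"
proof -
  let ?S = "{s_independence_number s {..<n} E | E. E \<subseteq> [{..<n}]\<^bsup>2\<^esup> \<and> multicolour_K_free (replicate t 3) {..<n} E}"
  have "triangle_colouring {..<t} {..<n} {} (\<lambda>_. 0)" by (rule triangle_colouringI) simp_all
  then have "multicolour_K_free (replicate t 3) {..<n} {}"
    by (subst multicolour_K_free_triangle_iff) auto
  then have "?S \<noteq> {}" by blast
  with finite_erdos_rogers_values have "Min ?S \<in> ?S" by (rule Min_in)
  then obtain E where E: "E \<subseteq> [{..<n}]\<^bsup>2\<^esup>" "multicolour_K_free (replicate t 3) {..<n} E"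
    and eq: "erdos_rogers s (replicate t 3) n = s_independence_number s {..<n} E"
    unfolding erdos_rogers_def by blast
  from E(2) obtain c where "triangle_colouring {..<t} {..<n} E c"
    unfolding multicolour_K_free_triangle_iff[OF E(1)] by blast
  moreover have "K_free_bound s {..<n} E (erdos_rogers s (replicate t 3) n)"
    unfolding eq by (rule K_free_bound_s_independence_number) simp
  ultimately show ?thesis using E(1) by blast
qed

section \<open>Pulling coloured graphs back along maps\<close>

text \<open>When \<open>E\<close> consists of pairs, the fibres of \<open>g\<close> are independent:
  a pair inside a fibre is mapped to a singleton, which is not an edge.\<close>

definition pullback :: "('a \<Rightarrow> 'b) \<Rightarrow> 'a set \<Rightarrow> 'b set set \<Rightarrow> 'a set set" where
  "pullback g V E = {e \<in> [V]\<^bsup>2\<^esup>. g ` e \<in> E}"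

lemma triangle_colouring_pullback:
  assumes "triangle_colouring J W E c" "E \<subseteq> [W]\<^bsup>2\<^esup>"
  shows "triangle_colouring J V (pullback g V E) (\<lambda>e. c (g ` e))"
proof -
  have edge: "g x \<in> W" "g y \<in> W" "g x \<noteq> g y" "{g x, g y} \<in> E"
    if "{x, y} \<in> pullback g V E" for x y
  proof -
    have "{g x, g y} \<in> E" using that by (simp add: pullback_def)
    moreover from this have "{g x, g y} \<in> [W]\<^bsup>2\<^esup>" using assms(2) by blast
    ultimately show "g x \<in> W" "g y \<in> W" "g x \<noteq> g y" "{g x, g y} \<in> E" by simp_all
  qed
  show ?thesis
  proof (rule triangle_colouringI, unfold image_insert image_empty)
    show "c {g x, g y} \<in> J" if "{x, y} \<in> pullback g V E" for x y
      using triangle_colouring_mem[OF assms(1)] edge[OF that] by blast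
  next
    fix x y z j
    assume "{x, y} \<in> pullback g V E" "{y, z} \<in> pullback g V E" "{x, z} \<in> pullback g V E"
      "c {g x, g y} = j" "c {g y, g z} = j" "c {g x, g z} = j"
    then show False
      using triangle_colouring_no_triangle[OF assms(1), of "g x" "g y" "g z" j] edge by blast
  qed
qed

lemma K_free_pullback_image:
  assumes "K_free s X (pullback g V E)" "X \<subseteq> V"
  shows "K_free s (g ` X) E"
  unfolding K_free_def
proof clarify
  fix H assume H: "H \<in> [g ` X]\<^bsup>s\<^esup>" "clique H E"
  then have "H \<subseteq> g ` X" by (simp add: nsets_def)
  then obtain Y where Y: "Y \<subseteq> X" "inj_on g Y" "H = g ` Y"
    by (meson subset_image_inj)
  have "Y \<in> [X]\<^bsup>s\<^esup>"
    using H(1) Y by (auto simp: nsets_def card_image finite_image_iff)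
  moreover have "clique Y (pullback g V E)"
    using H(2) Y assms(2) unfolding clique_def pullback_def by (auto dest: inj_onD)
  ultimately show False
    using assms(1) unfolding K_free_def by blast
qed

text \<open>Pulling back along an injection is passing to an induced subgraph with renamed vertices.
  This transfers a construction on any sufficiently large vertex set to
  \<open>{..<n}\<close>.\<close>

lemma graph_restrict_to_nat:
  assumes "E \<subseteq> [W]\<^bsup>2\<^esup>" "triangle_colouring J W E c" "K_free_bound s W E m" "finite W" "n \<le> card W"
  shows "\<exists>F d. F \<subseteq> [{..<n}]\<^bsup>2\<^esup> \<and> triangle_colouring J {..<n} F d \<and> K_free_bound s {..<n} F m"
proof -
  obtain W' where "W' \<subseteq> W" "card W' = n" "finite W'"
    using assms(4,5) by (meson obtain_subset_with_card_n)
  then obtain g where g: "bij_betw g {..<n} W'"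
    using bij_betw_from_nat_into_finite by blast
  then have gW: "g ` {..<n} \<subseteq> W" "inj_on g {..<n}"
    using \<open>W' \<subseteq> W\<close> by (auto simp: bij_betw_def)
  have "K_free_bound s {..<n} (pullback g {..<n} E) m"
  proof (rule K_free_boundI)
    fix X assume X: "X \<subseteq> {..<n}" "K_free s X (pullback g {..<n} E)"
    then have "card (g ` X) \<le> m"
      using gW(1) by (intro K_free_boundD[OF assms(3) _ K_free_pullback_image[OF X(2,1)]]) auto
    then show "card X \<le> m"
      using X(1) gW(2) by (simp add: card_image inj_on_subset)
  qed
  moreover have "pullback g {..<n} E \<subseteq> [{..<n}]\<^bsup>2\<^esup>" by (auto simp: pullback_def)
  ultimately show ?thesis
    using triangle_colouring_pullback[OF assms(2,1)] by blast
qed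

lemma erdos_rogers_le:
  assumes "E \<subseteq> [{..<n}]\<^bsup>2\<^esup>" "triangle_colouring {..<t} {..<n} E c" "K_free_bound s {..<n} E m" "s > 0"
  shows "erdos_rogers s (replicate t 3) n \<le> m"
proof -
  have "multicolour_K_free (replicate t 3) {..<n} E"
    using multicolour_K_free_triangle_iff[OF assms(1)] assms(2) by blast
  moreover have "s_independence_number s {..<n} E \<le> m"
    using assms(3,4) by (intro s_independence_number_le) auto
  ultimately show ?thesis
    unfolding erdos_rogers_def using assms(1)
    by (intro order_trans[OF Min_le[OF finite_erdos_rogers_values]]) blast+
qed

subsection \<open>Random blow-ups of coloured cliques\<close>

text \<open>The fibres of \<open>f i\<close> are the blocks of the \<open>i\<close>-th family, and
  \<open>p (i, P)\<close> is the part of \<open>P\<close> within its block. Every block carries a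
  complete \<open>s\<close>-partite graph; a point with label at least \<open>s\<close> is isolated
  within that block.\<close>

definition block_edges :: "nat \<Rightarrow> nat \<Rightarrow> (nat \<Rightarrow> 'p \<Rightarrow> 'b) \<Rightarrow> (nat \<times> 'p \<Rightarrow> nat) \<Rightarrow> 'p set \<Rightarrow> 'p set set" where
  "block_edges s r f p V =
     {e \<in> [V]\<^bsup>2\<^esup>. \<exists>i<r. (\<exists>b. f i ` e = {b}) \<and> (\<lambda>P. p (i, P)) ` e \<in> [{..<s}]\<^bsup>2\<^esup>}"

lemma block_edges_iff:
  "{x, y} \<in> block_edges s r f p V \<longleftrightarrow> x \<in> V \<and> y \<in> V \<and> x \<noteq> y \<and>
     (\<exists>i<r. f i x = f i y \<and> p (i, x) < s \<and> p (i, y) < s \<and> p (i, x) \<noteq> p (i, y))"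
proof -
  have "(\<exists>b. f i ` {x, y} = {b}) \<longleftrightarrow> f i x = f i y" for i
    by auto
  then show ?thesis
    unfolding block_edges_def by simp
qed

text \<open>An edge inherits the colour that \<open>chi\<close> gives to the two parts it joins. By
  \<open>girth\<close> a triangle lies in one block, where its corners occupy three different parts,
  so it maps to a triangle coloured by \<open>chi\<close>.\<close>

lemma triangle_colouring_block_edges:
  fixes f :: "nat \<Rightarrow> 'p \<Rightarrow> 'b"
  assumes girth: "\<And>i j l P Q R. i < r \<Longrightarrow> j < r \<Longrightarrow> l < r \<Longrightarrow> P \<in> V \<Longrightarrow> Q \<in> V \<Longrightarrow> R \<in> V \<Longrightarrow>
      P \<noteq> Q \<Longrightarrow> Q \<noteq> R \<Longrightarrow> P \<noteq> R \<Longrightarrow> f i P = f i Q \<Longrightarrow> f j Q = f j R \<Longrightarrow> f l P = f l R \<Longrightarrow> i = j \<and> j = l"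
    and chi: "triangle_colouring J {..<s} ([{..<s}]\<^bsup>2\<^esup>) chi"
  shows "\<exists>c. triangle_colouring J V (block_edges s r f p V) c"
proof -
  define ok where "ok = (\<lambda>x y i. i < r \<and> f i x = f i y \<and> p (i, x) < s \<and> p (i, y) < s \<and> p (i, x) \<noteq> p (i, y))"
  \<comment> \<open>The family is selected from the unordered edge, so that the colour becomes a
    function of the edge alone.\<close>
  define idx where "idx = (\<lambda>e. SOME i. \<forall>x\<in>e. \<forall>y\<in>e. x \<noteq> y \<longrightarrow> ok x y i)"
  have idx: "ok x y (idx {x, y})" if xy: "{x, y} \<in> block_edges s r f p V" for x y
  proof -
    obtain i where "ok x y i" "ok y x i" and "x \<noteq> y"
      using xy unfolding block_edges_iff ok_def by metis
    then have "\<forall>u\<in>{x, y}. \<forall>v\<in>{x, y}. u \<noteq> v \<longrightarrow> ok u v i" by simp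
    then have "\<forall>u\<in>{x, y}. \<forall>v\<in>{x, y}. u \<noteq> v \<longrightarrow> ok u v (idx {x, y})"
      unfolding idx_def by (rule someI)
    then show ?thesis using \<open>x \<noteq> y\<close> by simp
  qed
  define c where "c = (\<lambda>e. chi ((\<lambda>P. p (idx e, P)) ` e))"
  have "triangle_colouring J V (block_edges s r f p V) c"
  proof (rule triangle_colouringI)
    fix x y assume "{x, y} \<in> block_edges s r f p V"
    from idx[OF this] show "c {x, y} \<in> J"
      unfolding c_def image_insert image_empty ok_def
      by (intro triangle_colouring_mem[OF chi]) simp_all
  next
    fix x y z j
    assume V: "x \<in> V" "y \<in> V" "z \<in> V" "x \<noteq> y" "y \<noteq> z" "x \<noteq> z"
      and E: "{x, y} \<in> block_edges s r f p V" "{y, z} \<in> block_edges s r f p V" "{x, z} \<in> block_edges s r f p V"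
      and c: "c {x, y} = j" "c {y, z} = j" "c {x, z} = j"
    note ok = idx[OF E(1), unfolded ok_def] idx[OF E(2), unfolded ok_def] idx[OF E(3), unfolded ok_def]
    \<comment> \<open>The three families coincide, hence so do the three blocks, and the parts of
      all corners are given by the same \<open>i\<close>.\<close>
    have "idx {x, y} = idx {y, z} \<and> idx {y, z} = idx {x, z}"
      using ok by (intro girth[OF _ _ _ V]) simp_all
    then obtain i where i: "idx {x, y} = i" "idx {y, z} = i" "idx {x, z} = i" by simp
    show False
      using ok c unfolding c_def i image_insert image_empty
      by (intro triangle_colouring_no_triangle[OF chi, of "p (i, x)" "p (i, y)" "p (i, z)" j]) simp_all
  qed
  then show ?thesis by blast
qed

text \<open>If \<open>X\<close> met all \<open>s\<close> parts of a block, one point from each part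
  would give a clique on \<open>s\<close> vertices.\<close>

lemma K_free_block_edges_missing_part:
  assumes "K_free s X (block_edges s r f p V)" "X \<subseteq> V" "i < r"
  shows "\<exists>k<s. \<forall>P\<in>X. f i P = b \<longrightarrow> p (i, P) \<noteq> k"
proof (rule ccontr)
  assume "\<not> ?thesis"
  then have "\<forall>k\<in>{..<s}. \<exists>P. P \<in> X \<and> f i P = b \<and> p (i, P) = k" by auto
  then obtain g where g: "\<forall>k\<in>{..<s}. g k \<in> X \<and> f i (g k) = b \<and> p (i, g k) = k"
    by (rule bchoice[THEN exE])
  have inj: "inj_on g {..<s}"
    by (rule inj_on_inverseI[of _ "\<lambda>P. p (i, P)"]) (use g in simp)
  have "g ` {..<s} \<in> [X]\<^bsup>s\<^esup>"
    using g by (auto simp: nsets_def card_image[OF inj])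
  moreover have "clique (g ` {..<s}) (block_edges s r f p V)"
    unfolding clique_def block_edges_iff
  proof (intro ballI impI conjI)
    fix v w assume v: "v \<in> g ` {..<s}" and w: "w \<in> g ` {..<s}" and "v \<noteq> w"
    then show "\<exists>i<r. f i v = f i w \<and> p (i, v) < s \<and> p (i, w) < s \<and> p (i, v) \<noteq> p (i, w)"
      using g \<open>i < r\<close> by (intro exI[of _ i]) auto
    show "v \<in> V" "w \<in> V" "v \<noteq> w" using v w g assms(2) \<open>v \<noteq> w\<close> by auto
  qed
  ultimately show False
    using assms(1) unfolding K_free_def by blast
qed

section \<open>The union bound over random partitions\<close>

lemma card_avoiding_PiE:
  assumes "finite V" "X \<subseteq> V" "\<And>i P. i < r \<Longrightarrow> P \<in> X \<Longrightarrow> g i P < (s::nat)"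
  shows "card (PiE ({..<r} \<times> V) (\<lambda>(i, P). if P \<in> X then {..<s} - {g i P} else {..<s})) =
     (s - 1) ^ (r * card X) * s ^ (r * (card V - card X))"
proof -
  have "card (PiE ({..<r} \<times> V) (\<lambda>(i, P). if P \<in> X then {..<s} - {g i P} else {..<s})) =
     (\<Prod>(i, P)\<in>{..<r} \<times> V. if P \<in> X then s - 1 else s)"
    using assms by (subst card_PiE) (auto intro!: prod.cong)
  also have "\<dots> = (\<Prod>i<r. \<Prod>P\<in>V. if P \<in> X then s - 1 else s)"
    by (rule prod.cartesian_product[symmetric])
  also have "(\<Prod>P\<in>V. if P \<in> X then s - 1 else s) = (s - 1) ^ card X * s ^ (card V - card X)"
  proof -
    have "(\<Prod>P\<in>V. if P \<in> X then s - 1 else s) =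
      (\<Prod>P\<in>V - X. if P \<in> X then s - 1 else s) * (\<Prod>P\<in>X. if P \<in> X then s - 1 else s)"
      using assms by (intro prod.subset_diff)
    also have "(\<Prod>P\<in>V - X. if P \<in> X then s - 1 else s) = (\<Prod>P\<in>V - X. s)"
      by (intro prod.cong) auto
    also have "(\<Prod>P\<in>X. if P \<in> X then s - 1 else s) = (\<Prod>P\<in>X. s - 1)"
      by (intro prod.cong) auto
    finally show ?thesis
      using assms card_Diff_subset[of X V] finite_subset[of X V] by (simp add: mult.commute)
  qed
  finally show ?thesis
    by (simp add: power_mult_distrib power_mult mult.commute[of r])
qed

lemma card_nsets_le_power: "card ([V]\<^bsup>m\<^esup>) \<le> card V ^ m"
proof -
  have "(card V choose m) * 1 \<le> (card V choose m) * fact m"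
    by (intro mult_le_mono2) (simp add: fact_ge_1)
  also have "\<dots> \<le> card V ^ m" by (rule binomial_fact_pow)
  finally show ?thesis by simp
qed

text \<open>Union bound: a bad assignment \<open>p\<close> is witnessed by an \<open>m\<close>-set
  \<open>X\<close> and a choice \<open>mu\<close> of a missed part for each of the
  \<open>r * card B\<close> blocks. For a fixed witness each of the \<open>r * m\<close> labels of
  points of \<open>X\<close> loses one of its \<open>s\<close> values, and \<open>count\<close> says
  that all witnesses together cannot cover every assignment.\<close>

lemma exists_partition_without_missing_parts:
  fixes f :: "nat \<Rightarrow> 'p \<Rightarrow> 'b"
  assumes "finite V" "finite B" "\<And>i P. i < r \<Longrightarrow> P \<in> V \<Longrightarrow> f i P \<in> B"
    and count: "card V ^ m * s ^ (r * card B) * (s - 1) ^ (r * m) < s ^ (r * m)"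
    and "m \<le> card V" "s > 0"
  shows "\<exists>p. \<forall>X\<in>[V]\<^bsup>m\<^esup>. \<not> (\<forall>i<r. \<forall>b\<in>B. \<exists>k<s. \<forall>P\<in>X. f i P = b \<longrightarrow> p (i, P) \<noteq> k)"
proof (rule ccontr)
  assume "\<not> ?thesis"
  then have bad: "\<exists>X\<in>[V]\<^bsup>m\<^esup>. \<forall>i<r. \<forall>b\<in>B. \<exists>k<s. \<forall>P\<in>X. f i P = b \<longrightarrow> p (i, P) \<noteq> k" for p
    by blast
  \<comment> \<open>\<open>mu\<close> selects for every block a part that is missed by \<open>X\<close>\<close>
  define M where "M = ({..<r} \<times> B) \<rightarrow>\<^sub>E {..<s}"
  define Av where "Av = (\<lambda>X mu. PiE ({..<r} \<times> V) (\<lambda>(i, P). if P \<in> X then {..<s} - {mu (i, f i P)} else {..<s}))"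
  have finM: "finite M" "card M = s ^ (r * card B)"
    using assms(2) unfolding M_def by (simp_all add: finite_PiE card_funcsetE)
  have finX: "finite ([V]\<^bsup>m\<^esup>)" using assms(1) by (rule finite_imp_finite_nsets)
  have cardAv: "card (Av X mu) = (s - 1) ^ (r * m) * s ^ (r * (card V - m))" if "X \<in> [V]\<^bsup>m\<^esup>" "mu \<in> M" for X mu
  proof -
    have X: "X \<subseteq> V" "card X = m" using that(1) by (auto simp: nsets_def)
    have "mu (i, f i P) < s" if "i < r" "P \<in> X" for i P
      using \<open>mu \<in> M\<close> that assms(3) X(1) unfolding M_def by (auto simp: PiE_iff)
    from card_avoiding_PiE[OF assms(1) X(1) this] show ?thesis
      unfolding Av_def X(2) by simp
  qed
  have sub: "({..<r} \<times> V) \<rightarrow>\<^sub>E {..<s} \<subseteq> (\<Union>X\<in>[V]\<^bsup>m\<^esup>. \<Union>mu\<in>M. Av X mu)"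
  proof
    fix p assume p: "p \<in> ({..<r} \<times> V) \<rightarrow>\<^sub>E {..<s}"
    obtain X where X: "X \<in> [V]\<^bsup>m\<^esup>" "\<forall>i<r. \<forall>b\<in>B. \<exists>k<s. \<forall>P\<in>X. f i P = b \<longrightarrow> p (i, P) \<noteq> k"
      using bad by blast
    then have "\<forall>ib\<in>{..<r} \<times> B. \<exists>k. k < s \<and> (\<forall>P\<in>X. f (fst ib) P = snd ib \<longrightarrow> p (fst ib, P) \<noteq> k)"
      by auto
    then obtain mu where mu: "\<forall>ib\<in>{..<r} \<times> B. mu ib < s \<and> (\<forall>P\<in>X. f (fst ib) P = snd ib \<longrightarrow> p (fst ib, P) \<noteq> mu ib)"
      by (rule bchoice[THEN exE])
    have XV: "X \<subseteq> V" using X(1) by (simp add: nsets_def)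
    define mu' where "mu' = restrict mu ({..<r} \<times> B)"
    have "mu' \<in> M" using mu unfolding mu'_def M_def by auto
    moreover have "p \<in> Av X mu'"
      unfolding Av_def PiE_iff
    proof (intro conjI ballI)
      show "p \<in> extensional ({..<r} \<times> V)" using p by (simp add: PiE_iff)
      fix iP assume iP: "iP \<in> {..<r} \<times> V"
      obtain i P where iPeq: "iP = (i, P)" by (cases iP)
      with iP have "i < r" "P \<in> V" by auto
      then have "p (i, P) < s" using p by (auto simp: PiE_iff)
      moreover have "p (i, P) \<noteq> mu' (i, f i P)" if "P \<in> X"
        using mu that \<open>i < r\<close> \<open>P \<in> V\<close> assms(3) unfolding mu'_def by auto
      ultimately show "p iP \<in> (case iP of (i, P) \<Rightarrow> if P \<in> X then {..<s} - {mu' (i, f i P)} else {..<s})"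
        unfolding iPeq by simp
    qed
    ultimately show "p \<in> (\<Union>X\<in>[V]\<^bsup>m\<^esup>. \<Union>mu\<in>M. Av X mu)"
      using X(1) by blast
  qed
  have finAv: "finite (Av X mu)" for X mu
    unfolding Av_def using assms(1) by (intro finite_PiE) auto
  have "s ^ (r * card V) = card (({..<r} \<times> V) \<rightarrow>\<^sub>E {..<s})"
    using assms(1) by (simp add: card_funcsetE)
  also have "\<dots> \<le> card (\<Union>X\<in>[V]\<^bsup>m\<^esup>. \<Union>mu\<in>M. Av X mu)"
    by (intro card_mono sub finite_UN_I finX finM finAv)
  also have "\<dots> \<le> (\<Sum>X\<in>[V]\<^bsup>m\<^esup>. card (\<Union>mu\<in>M. Av X mu))"
    by (rule card_UN_le[OF finX])
  also have "\<dots> \<le> (\<Sum>X\<in>[V]\<^bsup>m\<^esup>. \<Sum>mu\<in>M. card (Av X mu))"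
    by (intro sum_mono card_UN_le finM)
  also have "\<dots> = (\<Sum>X\<in>[V]\<^bsup>m\<^esup>. \<Sum>mu\<in>M. (s - 1) ^ (r * m) * s ^ (r * (card V - m)))"
    by (intro sum.cong refl cardAv)
  also have "\<dots> = card ([V]\<^bsup>m\<^esup>) * (s ^ (r * card B) * ((s - 1) ^ (r * m) * s ^ (r * (card V - m))))"
    using finM(2) by simp
  also have "\<dots> \<le> card V ^ m * (s ^ (r * card B) * ((s - 1) ^ (r * m) * s ^ (r * (card V - m))))"
    by (intro mult_le_mono1 card_nsets_le_power)
  also have "\<dots> = (card V ^ m * s ^ (r * card B) * (s - 1) ^ (r * m)) * s ^ (r * (card V - m))"
    by (simp add: mult_ac)
  also have "\<dots> < s ^ (r * m) * s ^ (r * (card V - m))"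
    using \<open>s > 0\<close> by (intro mult_strict_right_mono[OF count]) simp
  also have "\<dots> = s ^ (r * card V)"
    using \<open>m \<le> card V\<close> by (simp flip: power_add distrib_left)
  finally show False by simp
qed

lemma block_graph_exists:
  fixes f :: "nat \<Rightarrow> 'p \<Rightarrow> 'b"
  assumes "finite V" "finite B" "\<And>i P. i < r \<Longrightarrow> P \<in> V \<Longrightarrow> f i P \<in> B"
    and girth: "\<And>i j l P Q R. i < r \<Longrightarrow> j < r \<Longrightarrow> l < r \<Longrightarrow> P \<in> V \<Longrightarrow> Q \<in> V \<Longrightarrow> R \<in> V \<Longrightarrow>
      P \<noteq> Q \<Longrightarrow> Q \<noteq> R \<Longrightarrow> P \<noteq> R \<Longrightarrow> f i P = f i Q \<Longrightarrow> f j Q = f j R \<Longrightarrow> f l P = f l R \<Longrightarrow> i = j \<and> j = l"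
    and chi: "triangle_colouring J {..<s} ([{..<s}]\<^bsup>2\<^esup>) chi"
    and count: "card V ^ m * s ^ (r * card B) * (s - 1) ^ (r * m) < s ^ (r * m)" and "s > 0"
  shows "\<exists>E c. E \<subseteq> [V]\<^bsup>2\<^esup> \<and> triangle_colouring J V E c \<and> K_free_bound s V E m"
proof (cases "m \<le> card V")
  case False
  \<comment> \<open>If \<open>V\<close> has fewer than \<open>m\<close> points, the edgeless graph
    already satisfies the size bound.\<close>
  have "triangle_colouring J V {} (\<lambda>_. 0)" by (rule triangle_colouringI) simp_all
  moreover have "K_free_bound s V {} m"
    using False card_mono[OF assms(1)] by (intro K_free_boundI) (meson le_trans nat_le_linear)
  ultimately show ?thesis by blast
next
  case True
  obtain p where p: "\<forall>X\<in>[V]\<^bsup>m\<^esup>. \<not> (\<forall>i<r. \<forall>b\<in>B. \<exists>k<s. \<forall>P\<in>X. f i P = b \<longrightarrow> p (i, P) \<noteq> k)"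
    using exists_partition_without_missing_parts[OF assms(1-3) count True \<open>s > 0\<close>] by (rule exE)
  obtain c where c: "triangle_colouring J V (block_edges s r f p V) c"
    using triangle_colouring_block_edges[where f = f, OF girth chi] by (rule exE)
  have "K_free_bound s V (block_edges s r f p V) m"
  proof (rule K_free_boundI, rule ccontr)
    fix X assume X: "X \<subseteq> V" "K_free s X (block_edges s r f p V)" and "\<not> card X \<le> m"
    then obtain Y where Y: "Y \<subseteq> X" "card Y = m" "finite Y"
      using obtain_subset_with_card_n[of m X] by auto
    then have "Y \<in> [V]\<^bsup>m\<^esup>" using X(1) by (auto simp: nsets_def)
    moreover have "\<forall>i<r. \<forall>b\<in>B. \<exists>k<s. \<forall>P\<in>Y. f i P = b \<longrightarrow> p (i, P) \<noteq> k"
      using K_free_block_edges_missing_part[OF K_free_subset[OF X(2) Y(1)]] X(1) Y(1)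
      by (meson subset_trans)
    ultimately show False using p by blast
  qed
  moreover have "block_edges s r f p V \<subseteq> [V]\<^bsup>2\<^esup>" by (auto simp: block_edges_def)
  ultimately show ?thesis using c by blast
qed

subsection \<open>A block system on a paraboloid\<close>

text \<open>The box for \<open>v\<close> is \<open>r\<close> times as long in each coordinate as the
  range of \<open>u\<close>, so subtracting \<open>i u\<close> with \<open>i < r\<close> at most
  doubles it. Hence there are about \<open>d ^ D\<close> times as many points as labels, up to the
  factor \<open>2 ^ (D + 1)\<close>.\<close>

definition paraboloid_points :: "nat \<Rightarrow> nat \<Rightarrow> nat \<Rightarrow> ((nat \<Rightarrow> int) \<times> (nat \<Rightarrow> int) \<times> int) set" where
  "paraboloid_points D d r =
     ({..<D} \<rightarrow>\<^sub>E {0..<int d}) \<times> ({..<D} \<rightarrow>\<^sub>E {0..<int (r * d)}) \<times> {0..<int (r * (D * d\<^sup>2))}"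

definition line_labels :: "nat \<Rightarrow> nat \<Rightarrow> nat \<Rightarrow> ((nat \<Rightarrow> int) \<times> int) set" where
  "line_labels D d r =
     ({..<D} \<rightarrow>\<^sub>E {- int (r * d)..<int (r * d)}) \<times> {- int (r * (D * d\<^sup>2))..<int (r * (D * d\<^sup>2))}"

text \<open>The point \<open>(x, a, h)\<close> stands for the pair of \<open>u = (x, |x|\<^sup>2)\<close> and \<open>v = (a, h)\<close>; its block of slope \<open>i\<close> is \<open>v - i u\<close>.\<close>

definition line_label :: "nat \<Rightarrow> nat \<Rightarrow> (nat \<Rightarrow> int) \<times> (nat \<Rightarrow> int) \<times> int \<Rightarrow> (nat \<Rightarrow> int) \<times> int" where
  "line_label D i = (\<lambda>(x, a, h). (\<lambda>k\<in>{..<D}. a k - int i * x k, h - int i * (\<Sum>k<D. (x k)\<^sup>2)))"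

lemma finite_paraboloid_points: "finite (paraboloid_points D d r)"
  unfolding paraboloid_points_def by (intro finite_cartesian_product finite_PiE) auto

lemma card_paraboloid_points: "card (paraboloid_points D d r) = d ^ D * ((r * d) ^ D * (r * (D * d\<^sup>2)))"
  unfolding paraboloid_points_def by (simp add: card_cartesian_product card_funcsetE del: of_nat_mult)

lemma finite_line_labels: "finite (line_labels D d r)"
  unfolding line_labels_def by (intro finite_cartesian_product finite_PiE) auto

lemma card_line_labels: "card (line_labels D d r) = (2 * (r * d)) ^ D * (2 * (r * (D * d\<^sup>2)))"
proof -
  have "card {- int n..<int n} = 2 * n" for n by simp
  then show ?thesis
    unfolding line_labels_def by (simp add: card_cartesian_product card_funcsetE del: of_nat_mult)
qed

lemma line_label_mem:
  assumes "i < r" "P \<in> paraboloid_points D d r"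
  shows "line_label D i P \<in> line_labels D d r"
proof -
  obtain x a h where P: "P = (x, a, h)" by (cases P)
  have mem: "x k \<in> {0..<int d}" "a k \<in> {0..<int (r * d)}" if "k < D" for k
    using assms(2) that unfolding P paraboloid_points_def by (auto simp: PiE_iff)
  have h: "h \<in> {0..<int (r * (D * d\<^sup>2))}"
    using assms(2) unfolding P paraboloid_points_def by simp
  have bound: "u - int i * v \<in> {- int (r * n)..<int (r * n)}" if "u \<in> {0..<int (r * n)}" "0 \<le> v" "v \<le> int n" for u v n
  proof -
    have "int i * v \<le> int r * int n" using that \<open>i < r\<close> by (intro mult_mono) auto
    moreover have "0 \<le> int i * v" using that by simp
    ultimately show ?thesis using that(1) by simp
  qed
  have "(\<Sum>k<D. (x k)\<^sup>2) \<le> (\<Sum>k<D. (int d)\<^sup>2)"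
    using mem(1) by (intro sum_mono power_mono) (simp_all add: less_imp_le)
  then have "(\<Sum>k<D. (x k)\<^sup>2) \<le> int (D * d\<^sup>2)" by simp
  moreover have "0 \<le> (\<Sum>k<D. (x k)\<^sup>2)" by (intro sum_nonneg) simp
  ultimately have "h - int i * (\<Sum>k<D. (x k)\<^sup>2) \<in> {- int (r * (D * d\<^sup>2))..<int (r * (D * d\<^sup>2))}"
    using bound[OF h] by blast
  moreover have "(\<lambda>k\<in>{..<D}. a k - int i * x k) \<in> {..<D} \<rightarrow>\<^sub>E {- int (r * d)..<int (r * d)}"
  proof (rule restrict_PiE_iff[THEN iffD2], rule ballI)
    fix k assume "k \<in> {..<D}"
    then show "a k - int i * x k \<in> {- int (r * d)..<int (r * d)}"
      using mem[of k] by (intro bound) auto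
  qed
  ultimately show ?thesis
    unfolding P line_label_def line_labels_def by simp
qed

lemma line_label_eqD:
  assumes "line_label D i (x, a, h) = line_label D i (x', a', h')"
  shows "k < D \<Longrightarrow> a k - a' k = int i * (x k - x' k)"
    and "h - h' = int i * ((\<Sum>k<D. (x k)\<^sup>2) - (\<Sum>k<D. (x' k)\<^sup>2))"
proof -
  assume "k < D"
  then show "a k - a' k = int i * (x k - x' k)"
    using assms unfolding line_label_def by (auto simp: algebra_simps dest!: fun_cong[of _ _ k])
next
  show "h - h' = int i * ((\<Sum>k<D. (x k)\<^sup>2) - (\<Sum>k<D. (x' k)\<^sup>2))"
    using assms unfolding line_label_def by (simp add: algebra_simps)
qed

text \<open>Within a block \<open>v\<close> is determined by \<open>u\<close>, and \<open>u\<close>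
  by \<open>x\<close>, so distinct points of a block differ in \<open>x\<close>.\<close>

lemma paraboloid_points_eqI:
  assumes "(x, a, h) \<in> paraboloid_points D d r" "(x', a', h') \<in> paraboloid_points D d r"
    and "line_label D i (x, a, h) = line_label D i (x', a', h')" "\<And>k. k < D \<Longrightarrow> x k = x' k"
  shows "(x, a, h) = (x', a', h')"
proof -
  have "a k = a' k" if "k < D" for k
    using line_label_eqD(1)[OF assms(3) that] assms(4)[OF that] by simp
  moreover have "(\<Sum>k<D. (x k)\<^sup>2) = (\<Sum>k<D. (x' k)\<^sup>2)"
    using assms(4) by (intro sum.cong) auto
  then have "h = h'" using line_label_eqD(2)[OF assms(3)] by simp
  moreover have "x = x'"
    using assms(1,2,4) unfolding paraboloid_points_def by (intro PiE_ext[of x "{..<D}" "\<lambda>_. {0..<int d}" x']) simp_all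
  moreover have "a = a'"
    using assms(1,2) calculation(1) unfolding paraboloid_points_def by (intro PiE_ext[of a "{..<D}" "\<lambda>_. {0..<int (r * d)}" a']) simp_all
  ultimately show ?thesis by simp
qed

text \<open>A proper affine combination of two points of a paraboloid lies off the paraboloid.\<close>

lemma paraboloid_affine_relation:
  fixes x y z :: "nat \<Rightarrow> int"
  assumes "\<And>k. k < D \<Longrightarrow> \<alpha> * x k + \<beta> * y k + \<gamma> * z k = 0"
    and "\<alpha> * (\<Sum>k<D. (x k)\<^sup>2) + \<beta> * (\<Sum>k<D. (y k)\<^sup>2) + \<gamma> * (\<Sum>k<D. (z k)\<^sup>2) = 0"
    and "\<alpha> + \<beta> + \<gamma> = 0" "\<beta> \<noteq> 0" "\<gamma> \<noteq> 0" "k < D"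
  shows "y k = z k"
proof -
  \<comment> \<open>Eliminating \<open>x k\<close> through the affine relation leaves a multiple of
    a square with the same factor in every coordinate; the extra factor \<open>\<alpha>\<close>
    avoids a division. Summation over \<open>k\<close> then forces a sum of squares to
    vanish.\<close>
  have "\<alpha> * (\<alpha> * (x k)\<^sup>2 + \<beta> * (y k)\<^sup>2 + \<gamma> * (z k)\<^sup>2) = - \<beta> * \<gamma> * (y k - z k)\<^sup>2" if "k < D" for k
  proof -
    have "\<alpha> * x k = - \<beta> * y k - \<gamma> * z k" using assms(1)[OF that] by simp
    then have "(\<alpha> * x k)\<^sup>2 = (\<beta> * y k + \<gamma> * z k)\<^sup>2" by algebra
    moreover have "\<alpha> = - \<beta> - \<gamma>" using assms(3) by simp
    ultimately show ?thesis by algebra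
  qed
  then have "(\<Sum>k<D. - \<beta> * \<gamma> * (y k - z k)\<^sup>2) =
      \<alpha> * (\<alpha> * (\<Sum>k<D. (x k)\<^sup>2) + \<beta> * (\<Sum>k<D. (y k)\<^sup>2) + \<gamma> * (\<Sum>k<D. (z k)\<^sup>2))"
    unfolding sum_distrib_left sum.distrib[symmetric] by (intro sum.cong) (auto simp: algebra_simps)
  then have "- \<beta> * \<gamma> * (\<Sum>k<D. (y k - z k)\<^sup>2) = 0"
    unfolding assms(2) by (simp add: sum_distrib_left)
  then have "(\<Sum>k<D. (y k - z k)\<^sup>2) = 0" using assms(4,5) by simp
  then have "(y k - z k)\<^sup>2 = 0"
    using assms(6) by (subst (asm) sum_nonneg_eq_0_iff) auto
  then show ?thesis by simp
qed

text \<open>Combining the three label equations eliminates the \<open>v\<close> components and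
  leaves an affine relation between three points of the paraboloid with coefficients
  \<open>i - l\<close>, \<open>j - i\<close> and \<open>l - j\<close>. By strict convexity two of
  the slopes agree. The relation then involves only two points and would identify them if the third
  slope were different.\<close>

lemma line_label_girth:
  assumes "P \<in> paraboloid_points D d r" "Q \<in> paraboloid_points D d r" "R \<in> paraboloid_points D d r"
    and "P \<noteq> Q" "Q \<noteq> R" "P \<noteq> R"
    and "line_label D i P = line_label D i Q" "line_label D j Q = line_label D j R" "line_label D l P = line_label D l R"
  shows "i = j \<and> j = l"
proof -
  obtain x a h where P: "P = (x, a, h)" by (cases P)
  obtain y b g where Q: "Q = (y, b, g)" by (cases Q)
  obtain z c f where R: "R = (z, c, f)" by (cases R)
  note [simp] = P Q R
  let ?n = "\<lambda>x :: nat \<Rightarrow> int. \<Sum>k<D. (x k)\<^sup>2"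
  have lin: "(int i - int l) * x k + (int j - int i) * y k + (int l - int j) * z k = 0" if "k < D" for k
    using line_label_eqD(1)[OF assms(7)[unfolded P Q] that] line_label_eqD(1)[OF assms(8)[unfolded Q R] that]
      line_label_eqD(1)[OF assms(9)[unfolded P R] that] by (simp add: algebra_simps)
  have quad: "(int i - int l) * ?n x + (int j - int i) * ?n y + (int l - int j) * ?n z = 0"
    using line_label_eqD(2)[OF assms(7)[unfolded P Q]] line_label_eqD(2)[OF assms(8)[unfolded Q R]]
      line_label_eqD(2)[OF assms(9)[unfolded P R]] by (simp add: algebra_simps)
  have nyz: "\<not> (\<forall>k<D. y k = z k)"
    using paraboloid_points_eqI[of y b g D d r z c f j] assms(2,3,5,8) by auto
  have nxz: "\<not> (\<forall>k<D. x k = z k)"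
    using paraboloid_points_eqI[of x a h D d r z c f l] assms(1,3,6,9) by auto
  have "i = j \<or> j = l"
  proof (rule ccontr)
    assume "\<not> ?thesis"
    then have "y k = z k" if "k < D" for k
      using that by (intro paraboloid_affine_relation[OF lin quad]) auto
    with nyz show False by blast
  qed
  then show ?thesis
  proof
    assume "i = j"
    moreover have "i = l"
    proof (rule ccontr)
      assume "i \<noteq> l"
      have "x k = z k" if "k < D" for k
      proof -
        have "(int i - int l) * (x k - z k) = 0"
          using lin[OF that] \<open>i = j\<close> by (simp add: algebra_simps)
        then show ?thesis using \<open>i \<noteq> l\<close> by simp
      qed
      with nxz show False by blast
    qed
    ultimately show ?thesis by simp
  next
    assume "j = l"
    moreover have "i = l"
    proof (rule ccontr)
      assume "i \<noteq> l"
      have "x k = y k" if "k < D" for k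
      proof -
        have "(int i - int l) * (x k - y k) = 0"
          using lin[OF that] \<open>j = l\<close> by (simp add: algebra_simps)
        then show ?thesis using \<open>i \<noteq> l\<close> by simp
      qed
      then show False
        using paraboloid_points_eqI[of x a h D d r y b g i] assms(1,2,4,7) by simp
    qed
    ultimately show ?thesis by simp
  qed
qed

lemma paraboloid_graph_exists:
  assumes chi: "triangle_colouring J {..<s} ([{..<s}]\<^bsup>2\<^esup>) chi" and "s > 0"
    and N: "N = d ^ D * ((r * d) ^ D * (r * (D * d\<^sup>2)))"
    and b: "b = (2 * (r * d)) ^ D * (2 * (r * (D * d\<^sup>2)))"
    and count: "N ^ m * s ^ (r * b) * (s - 1) ^ (r * m) < s ^ (r * m)"
  shows "\<exists>V :: ((nat \<Rightarrow> int) \<times> (nat \<Rightarrow> int) \<times> int) set. \<exists>E c. finite V \<and> card V = N \<and> E \<subseteq> [V]\<^bsup>2\<^esup> \<and>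
    triangle_colouring J V E c \<and> K_free_bound s V E m"
proof -
  have "\<exists>E c. E \<subseteq> [paraboloid_points D d r]\<^bsup>2\<^esup> \<and> triangle_colouring J (paraboloid_points D d r) E c \<and>
      K_free_bound s (paraboloid_points D d r) E m"
  proof (rule block_graph_exists[where f = "line_label D", OF finite_paraboloid_points finite_line_labels _ _ chi _ \<open>s > 0\<close>])
    show "card (paraboloid_points D d r) ^ m * s ^ (r * card (line_labels D d r)) * (s - 1) ^ (r * m) < s ^ (r * m)"
      using count unfolding N b card_paraboloid_points card_line_labels .
  next
    show "i = j \<and> j = l"
      if "P \<in> paraboloid_points D d r" "Q \<in> paraboloid_points D d r" "R \<in> paraboloid_points D d r"
        "P \<noteq> Q" "Q \<noteq> R" "P \<noteq> R" "line_label D i P = line_label D i Q"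
        "line_label D j Q = line_label D j R" "line_label D l P = line_label D l R" for i j l P Q R
      using that by (rule line_label_girth)
  qed (rule line_label_mem)
  then show ?thesis
    by (intro exI[of _ "paraboloid_points D d r"]) (simp add: finite_paraboloid_points card_paraboloid_points N)
qed

subsection \<open>Doubling the number of colours\<close>

text \<open>A common edge keeps its colour from \<open>E1\<close>, and the colours of
  \<open>E2\<close> are shifted by \<open>t\<close>. The colour therefore reveals the graph, so a
  monochromatic triangle would lie in one of the two graphs.\<close>

lemma triangle_colouring_Un:
  assumes "triangle_colouring {..<t} V E1 c1" "triangle_colouring {..<u} V E2 c2"
  shows "triangle_colouring {..<t + u} V (E1 \<union> E2) (\<lambda>e. if e \<in> E1 then c1 e else t + c2 e)"
    (is "triangle_colouring _ _ _ ?c")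
proof (rule triangle_colouringI)
  fix x y assume xy: "x \<in> V" "y \<in> V" "x \<noteq> y" "{x, y} \<in> E1 \<union> E2"
  then show "?c {x, y} \<in> {..<t + u}"
    using triangle_colouring_mem[OF assms(1) xy(1-3)] triangle_colouring_mem[OF assms(2) xy(1-3)] by auto
next
  fix x y z j
  assume V: "x \<in> V" "y \<in> V" "z \<in> V" "x \<noteq> y" "y \<noteq> z" "x \<noteq> z"
    and E: "{x, y} \<in> E1 \<union> E2" "{y, z} \<in> E1 \<union> E2" "{x, z} \<in> E1 \<union> E2"
    and c: "?c {x, y} = j" "?c {y, z} = j" "?c {x, z} = j"
  have in1: "{v, w} \<in> E1 \<longleftrightarrow> j < t" if "?c {v, w} = j" "v \<in> V" "w \<in> V" "v \<noteq> w" for v w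
    using triangle_colouring_mem[OF assms(1) that(2-4)] that(1) by (auto split: if_splits)
  note in1 = in1[OF c(1) V(1,2,4)] in1[OF c(2) V(2,3,5)] in1[OF c(3) V(1,3,6)]
  show False
  proof (cases "j < t")
    case True
    with in1 c show False
      by (intro triangle_colouring_no_triangle[OF assms(1) V]) simp_all
  next
    case False
    with in1 c E show False
      by (intro triangle_colouring_no_triangle[OF assms(2) V, of "j - t"]) auto
  qed
qed

lemma K_free_edge_mono: "K_free s X E \<Longrightarrow> F \<subseteq> E \<Longrightarrow> K_free s X F"
  unfolding K_free_def clique_def by blast

lemma card_PiE_restricted:
  assumes "finite V" "X \<subseteq> V"
  shows "card (PiE V (\<lambda>v. if v \<in> X then A else B)) = card A ^ card X * card B ^ (card V - card X)"
proof -
  have "card (PiE V (\<lambda>v. if v \<in> X then A else B)) = (\<Prod>v\<in>V. if v \<in> X then card A else card B)"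
    using assms(1) by (subst card_PiE) (auto intro!: prod.cong)
  also have "\<dots> = (\<Prod>v\<in>V - X. if v \<in> X then card A else card B) * (\<Prod>v\<in>X. if v \<in> X then card A else card B)"
    using assms by (intro prod.subset_diff)
  also have "(\<Prod>v\<in>V - X. if v \<in> X then card A else card B) = (\<Prod>v\<in>V - X. card B)"
    by (intro prod.cong) auto
  also have "(\<Prod>v\<in>X. if v \<in> X then card A else card B) = (\<Prod>v\<in>X. card A)"
    by (intro prod.cong) auto
  finally show ?thesis
    using assms card_Diff_subset[of X V] finite_subset[of X V] by (simp add: mult.commute)
qed

text \<open>Union bound over \<open>X\<close>, \<open>Y\<close> and \<open>Z\<close>: a uniformly
  random map to \<open>W \<times> W\<close> sends a fixed \<open>T\<close>-set into a fixed
  \<open>Y \<times> Z\<close> with probability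
  \<open>(\<alpha>\<^sup>2 / (card W)\<^sup>2) ^ T\<close>.\<close>

lemma exists_scattered_map:
  assumes "finite V" "finite W" "T \<le> card V"
    and "W \<noteq> {}"
    and count: "(card V choose T) * (card W choose \<alpha>)\<^sup>2 * (\<alpha>\<^sup>2) ^ T < ((card W)\<^sup>2) ^ T"
  shows "\<exists>p\<in>V \<rightarrow> W \<times> W. \<forall>X\<in>[V]\<^bsup>T\<^esup>. \<forall>Y\<in>[W]\<^bsup>\<alpha>\<^esup>. \<forall>Z\<in>[W]\<^bsup>\<alpha>\<^esup>. \<not> p ` X \<subseteq> Y \<times> Z"
proof (rule ccontr)
  assume "\<not> ?thesis"
  then have bad: "\<exists>X\<in>[V]\<^bsup>T\<^esup>. \<exists>Y\<in>[W]\<^bsup>\<alpha>\<^esup>. \<exists>Z\<in>[W]\<^bsup>\<alpha>\<^esup>. p ` X \<subseteq> Y \<times> Z" if "p \<in> V \<rightarrow> W \<times> W" for p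
    using that by simp
  define Av where "Av = (\<lambda>X Y Z. PiE V (\<lambda>v. if v \<in> X then Y \<times> Z else W \<times> W))"
  have fin: "finite ([V]\<^bsup>T\<^esup>)" "finite ([W]\<^bsup>\<alpha>\<^esup>)" using assms by (simp_all add: finite_imp_finite_nsets)
  have cardAv: "card (Av X Y Z) = (\<alpha>\<^sup>2) ^ T * ((card W)\<^sup>2) ^ (card V - T)"
    if "X \<in> [V]\<^bsup>T\<^esup>" "Y \<in> [W]\<^bsup>\<alpha>\<^esup>" "Z \<in> [W]\<^bsup>\<alpha>\<^esup>" for X Y Z
  proof -
    have "X \<subseteq> V" "card X = T" "card Y = \<alpha>" "card Z = \<alpha>" using that by (auto simp: nsets_def)
    then show ?thesis
      unfolding Av_def using card_PiE_restricted[OF assms(1), of X "Y \<times> Z" "W \<times> W"]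
      by (simp add: card_cartesian_product power2_eq_square)
  qed
  have sub: "V \<rightarrow>\<^sub>E W \<times> W \<subseteq> (\<Union>X\<in>[V]\<^bsup>T\<^esup>. \<Union>Y\<in>[W]\<^bsup>\<alpha>\<^esup>. \<Union>Z\<in>[W]\<^bsup>\<alpha>\<^esup>. Av X Y Z)"
  proof
    fix p assume p: "p \<in> V \<rightarrow>\<^sub>E W \<times> W"
    then have "p \<in> V \<rightarrow> W \<times> W" by (simp add: PiE_def)
    from bad[OF this] obtain X Y Z where XYZ: "X \<in> [V]\<^bsup>T\<^esup>" "Y \<in> [W]\<^bsup>\<alpha>\<^esup>" "Z \<in> [W]\<^bsup>\<alpha>\<^esup>" "p ` X \<subseteq> Y \<times> Z"
      by blast
    have "p \<in> Av X Y Z"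
      unfolding Av_def PiE_iff
    proof (intro conjI ballI)
      fix v assume "v \<in> V"
      then have "p v \<in> W \<times> W" using p by (rule PiE_mem[rotated])
      then show "p v \<in> (if v \<in> X then Y \<times> Z else W \<times> W)" using XYZ(4) by auto
    qed (use p in \<open>simp add: PiE_def\<close>)
    then show "p \<in> (\<Union>X\<in>[V]\<^bsup>T\<^esup>. \<Union>Y\<in>[W]\<^bsup>\<alpha>\<^esup>. \<Union>Z\<in>[W]\<^bsup>\<alpha>\<^esup>. Av X Y Z)"
      using XYZ(1-3) by blast
  qed
  have finAv: "finite (Av X Y Z)" if "Y \<in> [W]\<^bsup>\<alpha>\<^esup>" "Z \<in> [W]\<^bsup>\<alpha>\<^esup>" for X Y Z
    unfolding Av_def using that assms(1,2) by (intro finite_PiE) (auto simp: nsets_def)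
  have "((card W)\<^sup>2) ^ card V = card (V \<rightarrow>\<^sub>E W \<times> W)"
    using assms(1) by (simp add: card_funcsetE card_cartesian_product power2_eq_square)
  also have "\<dots> \<le> card (\<Union>X\<in>[V]\<^bsup>T\<^esup>. \<Union>Y\<in>[W]\<^bsup>\<alpha>\<^esup>. \<Union>Z\<in>[W]\<^bsup>\<alpha>\<^esup>. Av X Y Z)"
    by (intro card_mono sub finite_UN_I fin finAv)
  also have "\<dots> \<le> (\<Sum>X\<in>[V]\<^bsup>T\<^esup>. card (\<Union>Y\<in>[W]\<^bsup>\<alpha>\<^esup>. \<Union>Z\<in>[W]\<^bsup>\<alpha>\<^esup>. Av X Y Z))"
    by (rule card_UN_le[OF fin(1)])
  also have "\<dots> \<le> (\<Sum>X\<in>[V]\<^bsup>T\<^esup>. \<Sum>Y\<in>[W]\<^bsup>\<alpha>\<^esup>. card (\<Union>Z\<in>[W]\<^bsup>\<alpha>\<^esup>. Av X Y Z))"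
    by (intro sum_mono card_UN_le fin)
  also have "\<dots> \<le> (\<Sum>X\<in>[V]\<^bsup>T\<^esup>. \<Sum>Y\<in>[W]\<^bsup>\<alpha>\<^esup>. \<Sum>Z\<in>[W]\<^bsup>\<alpha>\<^esup>. card (Av X Y Z))"
    by (intro sum_mono card_UN_le fin)
  also have "\<dots> = (\<Sum>X\<in>[V]\<^bsup>T\<^esup>. \<Sum>Y\<in>[W]\<^bsup>\<alpha>\<^esup>. \<Sum>Z\<in>[W]\<^bsup>\<alpha>\<^esup>. (\<alpha>\<^sup>2) ^ T * ((card W)\<^sup>2) ^ (card V - T))"
    by (intro sum.cong refl cardAv)
  also have "\<dots> = ((card V choose T) * (card W choose \<alpha>)\<^sup>2 * (\<alpha>\<^sup>2) ^ T) * ((card W)\<^sup>2) ^ (card V - T)"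
    by (simp add: power2_eq_square)
  also have "\<dots> < ((card W)\<^sup>2) ^ T * ((card W)\<^sup>2) ^ (card V - T)"
    using \<open>W \<noteq> {}\<close> \<open>finite W\<close> by (intro mult_strict_right_mono[OF count]) (simp add: card_gt_0_iff)
  also have "\<dots> = ((card W)\<^sup>2) ^ card V"
    using assms(3) by (simp flip: power_add)
  finally show False by simp
qed

text \<open>A set that is \<open>K_s\<close>-free in the union is \<open>K_s\<close>-free in both
  pullbacks. Each projection of a \<open>T\<close>-subset then has at most \<open>\<alpha>\<close>
  elements, so that subset lands in a product \<open>Y \<times> Z\<close>, which a scattered map
  forbids.\<close>

lemma product_graph_exists:
  assumes E: "E \<subseteq> [W]\<^bsup>2\<^esup>" "triangle_colouring {..<t} W E c" "K_free_bound s W E \<alpha>"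
    and "finite W" "\<alpha> \<le> card W" "finite V"
    and "W \<noteq> {}"
    and count: "(card V choose T) * (card W choose \<alpha>)\<^sup>2 * (\<alpha>\<^sup>2) ^ T < ((card W)\<^sup>2) ^ T"
  shows "\<exists>F d. F \<subseteq> [V]\<^bsup>2\<^esup> \<and> triangle_colouring {..<t + t} V F d \<and> K_free_bound s V F T"
proof (cases "T \<le> card V")
  case False
  have "triangle_colouring {..<t + t} V {} (\<lambda>_. 0)" by (rule triangle_colouringI) simp_all
  moreover have "K_free_bound s V {} T"
  proof (rule K_free_boundI)
    fix X assume "X \<subseteq> V"
    then show "card X \<le> T" using card_mono[OF \<open>finite V\<close>, of X] False by simp
  qed
  ultimately show ?thesis by blast
next
  case True
  obtain p where p: "p \<in> V \<rightarrow> W \<times> W"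
    and scat: "\<forall>X\<in>[V]\<^bsup>T\<^esup>. \<forall>Y\<in>[W]\<^bsup>\<alpha>\<^esup>. \<forall>Z\<in>[W]\<^bsup>\<alpha>\<^esup>. \<not> p ` X \<subseteq> Y \<times> Z"
    using exists_scattered_map[OF \<open>finite V\<close> \<open>finite W\<close> True \<open>W \<noteq> {}\<close> count] by (rule bexE)
  let ?F1 = "pullback (fst \<circ> p) V E" and ?F2 = "pullback (snd \<circ> p) V E"
  have "K_free_bound s V (?F1 \<union> ?F2) T"
  proof (rule K_free_boundI, rule ccontr)
    fix X assume X: "X \<subseteq> V" "K_free s X (?F1 \<union> ?F2)" and "\<not> card X \<le> T"
    then obtain X' where X': "X' \<subseteq> X" "card X' = T" "finite X'"
      using obtain_subset_with_card_n[of T X] by auto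
    \<comment> \<open>Scatteredness concerns sets of exactly \<open>\<alpha>\<close> elements, so
      the projection is enlarged within \<open>W\<close>.\<close>
    have sup: "\<exists>Y\<in>[W]\<^bsup>\<alpha>\<^esup>. g ` X' \<subseteq> Y" if "g \<in> V \<rightarrow> W" "K_free s X (pullback g V E)" for g
    proof -
      have gX: "g ` X' \<subseteq> W" using that(1) X(1) X'(1) by auto
      moreover have "card (g ` X') \<le> \<alpha>"
        by (rule K_free_boundD[OF E(3) gX K_free_pullback_image[OF K_free_subset[OF that(2) X'(1)] subset_trans[OF X'(1) X(1)]]])
      ultimately obtain Y where "g ` X' \<subseteq> Y" "Y \<subseteq> W" "card Y = \<alpha>"
        using exists_subset_between[of "g ` X'" \<alpha> W] assms(4,5) by auto
      then show ?thesis using finite_subset[OF _ \<open>finite W\<close>] by (auto simp: nsets_def)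
    qed
    have "fst \<circ> p \<in> V \<rightarrow> W" "snd \<circ> p \<in> V \<rightarrow> W"
      using p by (simp_all add: Pi_iff mem_Times_iff)
    from sup[OF this(1) K_free_edge_mono[OF X(2) Un_upper1]] sup[OF this(2) K_free_edge_mono[OF X(2) Un_upper2]]
    obtain Y Z where Y: "Y \<in> [W]\<^bsup>\<alpha>\<^esup>" "(fst \<circ> p) ` X' \<subseteq> Y" and Z: "Z \<in> [W]\<^bsup>\<alpha>\<^esup>" "(snd \<circ> p) ` X' \<subseteq> Z"
      by (elim bexE)
    have "p ` X' \<subseteq> Y \<times> Z" using Y(2) Z(2) by (simp add: image_subset_iff mem_Times_iff)
    moreover have "X' \<in> [V]\<^bsup>T\<^esup>" using X' X(1) by (auto simp: nsets_def)
    ultimately show False using scat Y(1) Z(1) by blast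
  qed
  moreover have "?F1 \<union> ?F2 \<subseteq> [V]\<^bsup>2\<^esup>" by (auto simp: pullback_def)
  moreover note triangle_colouring_Un[OF triangle_colouring_pullback[OF E(2,1)] triangle_colouring_pullback[OF E(2,1)]]
  ultimately show ?thesis by blast
qed

subsection \<open>Asymptotic upper bounds\<close>

text \<open>Of the factor 4, one 2 will pay for the choice of the point set and the other for the
  choice of the missed parts.\<close>

lemma exists_four_fold_decay:
  fixes s :: nat
  assumes "s > 0"
  shows "\<exists>K. K > 0 \<and> 4 * (s - 1) ^ K \<le> s ^ K"
proof -
  have "(\<lambda>K. (real (s - 1) / real s) ^ K) \<longlonglongrightarrow> 0"
    using assms by (intro LIMSEQ_realpow_zero) (auto simp: field_simps)
  then have "eventually (\<lambda>K. (real (s - 1) / real s) ^ K < 1 / 4) sequentially"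
    by (rule order_tendstoD) simp
  then have "eventually (\<lambda>K. K > 0 \<and> (real (s - 1) / real s) ^ K < 1 / 4) sequentially"
    using eventually_gt_at_top[of 0] by eventually_elim simp
  from eventually_happens'[OF sequentially_bot this]
  obtain K where K: "K > 0" "(real (s - 1) / real s) ^ K < 1 / 4" by (elim exE conjE)
  then have "4 * real (s - 1) ^ K \<le> real s ^ K"
    using assms by (simp add: power_divide field_simps)
  then have "real (4 * (s - 1) ^ K) \<le> real (s ^ K)" by simp
  with K(1) show ?thesis unfolding of_nat_le_iff by blast
qed

text \<open>The hypothesis of the union bound for \<open>r = K * \<rho>\<close>. The value of
  \<open>m\<close> comes from \<open>s < 2 ^ s\<close>, which bounds the number of choices of missed
  parts by \<open>2 ^ (\<rho> * (s * K * b))\<close>; the summand 1 makes the comparison with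
  \<open>2 ^ (\<rho> * m)\<close> strict.\<close>

lemma block_graph_count:
  fixes N m s b K \<rho> :: nat
  assumes "4 * (s - 1) ^ K \<le> s ^ K" "N \<le> 2 ^ \<rho>" "m = s * K * b + 1" "s \<ge> 2" "K > 0" "\<rho> > 0"
  shows "N ^ m * s ^ (K * \<rho> * b) * (s - 1) ^ (K * \<rho> * m) < s ^ (K * \<rho> * m)"
proof -
  have "N ^ m \<le> (2 ^ \<rho>) ^ m" using assms(2) by (rule power_mono) simp
  moreover have "s ^ (K * \<rho> * b) < (2 ^ \<rho>) ^ m"
  proof -
    have "s ^ (K * \<rho> * b) \<le> (2 ^ s) ^ (K * \<rho> * b)"
      by (rule power_mono[OF less_imp_le[OF less_exp]]) simp
    also have "\<dots> = 2 ^ (\<rho> * (s * K * b))" by (simp flip: power_mult add: mult_ac)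
    also have "\<dots> < 2 ^ (\<rho> * m)"
      using assms(3,6) by (intro power_strict_increasing) auto
    finally show ?thesis by (simp add: power_mult)
  qed
  ultimately have "N ^ m * s ^ (K * \<rho> * b) < (2 ^ \<rho>) ^ m * (2 ^ \<rho>) ^ m"
    by (intro le_less_trans[OF mult_le_mono1 mult_strict_left_mono]) simp_all
  also have "\<dots> = 4 ^ (\<rho> * m)"
    by (simp add: power_mult power_mult_distrib[symmetric])
  finally have "N ^ m * s ^ (K * \<rho> * b) * (s - 1) ^ (K * \<rho> * m) < 4 ^ (\<rho> * m) * (s - 1) ^ (K * \<rho> * m)"
    using assms(4) by (intro mult_strict_right_mono) auto
  also have "\<dots> = (4 * (s - 1) ^ K) ^ (\<rho> * m)"
    by (simp add: power_mult_distrib mult.assoc flip: power_mult)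
  also have "\<dots> \<le> (s ^ K) ^ (\<rho> * m)"
    using assms(1) by (rule power_mono) simp
  finally show ?thesis by (simp add: mult.assoc flip: power_mult)
qed

text \<open>The bound \<open>m\<close> is linear in the number \<open>b\<close> of labels, and
  \<open>b\<close> is roughly the square root of the number of points once the dimension
  \<open>D\<close> is large. Only logarithmically many slopes would be demanded by the union bound;
  a small power of \<open>n\<close> is used instead.\<close>

lemma sqrt_upper_bound:
  assumes chi: "triangle_colouring J {..<s} ([{..<s}]\<^bsup>2\<^esup>) chi" and "s \<ge> 2" and "\<epsilon> > 0"
  shows "\<forall>\<^sub>F n in sequentially. \<exists>E c m. E \<subseteq> [{..<n}]\<^bsup>2\<^esup> \<and> triangle_colouring J {..<n} E c \<and>
    K_free_bound s {..<n} E m \<and> real m \<le> real n powr (1/2 + \<epsilon>)"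
proof -
  obtain K where K: "K > 0" "4 * (s - 1) ^ K \<le> s ^ K"
    using exists_four_fold_decay[of s] \<open>s \<ge> 2\<close> by auto
  obtain D :: nat where D: "D > 0" "1 / real D < \<epsilon>"
    using \<open>\<epsilon> > 0\<close> by (metis nat_approx_posE zero_less_Suc)
  \<comment> \<open>\<open>A\<close> and \<open>A'\<close> are the degrees in \<open>\<rho>\<close>
    of the number of points and of the number of labels.\<close>
  define A where "A = 2 * D\<^sup>2 + 3 * D + 1"
  define A' where "A' = D\<^sup>2 + 3 * D + 1"
  \<comment> \<open>the parameters are \<open>r = K \<rho>\<close> and \<open>d = \<rho> ^ D\<close>, which makes \<open>N\<close> and \<open>b\<close> monomials in \<open>\<rho>\<close>\<close>
  define C where "C = K ^ (D + 1) * D"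
  define N where "N = (\<lambda>\<rho>. C * \<rho> ^ A)"
  define b where "b = (\<lambda>\<rho>. 2 ^ (D + 1) * C * \<rho> ^ A')"
  have "C > 0" using K(1) D(1) by (simp add: C_def)
  have N_eq: "N \<rho> = (\<rho> ^ D) ^ D * ((K * \<rho> * \<rho> ^ D) ^ D * (K * \<rho> * (D * (\<rho> ^ D)\<^sup>2)))" for \<rho>
  proof -
    have "A = D * D + (D + (D * D + (1 + D * 2)))" by (simp add: A_def power2_eq_square)
    then show ?thesis
      unfolding N_def C_def
      by (simp only: power_add power_mult_distrib power_mult[symmetric] power_one_right mult_ac)
  qed
  have b_eq: "b \<rho> = (2 * (K * \<rho> * \<rho> ^ D)) ^ D * (2 * (K * \<rho> * (D * (\<rho> ^ D)\<^sup>2)))" for \<rho>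
  proof -
    have "A' = D + (D * D + (1 + D * 2))" by (simp add: A'_def power2_eq_square)
    then show ?thesis
      unfolding b_def C_def
      by (simp only: power_add power_mult_distrib power_mult[symmetric] power_one_right mult_ac)
  qed
  have exp: "real A' / real A < 1/2 + \<epsilon>"
  proof -
    have "A > 0" by (simp add: A_def)
    then have A_pos: "real A > 0" and "real D > 0" using D(1) by simp_all
    \<comment> \<open>Expanded, this compares \<open>2 D^3 + 6 D^2 + 2 D\<close> with
      \<open>2 D^3 + 7 D^2 + 7 D + 2\<close>.\<close>
    have "real A' * (2 * real D) \<le> (real D + 2) * real A"
      unfolding A'_def A_def by (simp add: algebra_simps power2_eq_square)
    then have "real A' / real A \<le> (real D + 2) / (2 * real D)"
      using A_pos \<open>real D > 0\<close> by (simp add: field_simps)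
    also have "\<dots> = 1/2 + 1 / real D" using \<open>real D > 0\<close> by (simp add: field_simps)
    finally show ?thesis using D(2) by simp
  qed
  \<comment> \<open>\<open>R n\<close> is the least \<open>\<rho>\<close> whose \<open>A\<close>-th
    power reaches \<open>n\<close>, so at least \<open>n\<close> points are available; rounding up
    costs at most a factor 2.\<close>
  define R where "R = (\<lambda>n::nat. nat \<lceil>real n powr (1 / real A)\<rceil>)"
  have "A > 0" by (simp add: A_def)
  have R_top: "filterlim R at_top sequentially"
    unfolding R_def using \<open>A > 0\<close> by real_asymp
  have "eventually (\<lambda>\<rho>::nat. real C * real \<rho> ^ A \<le> 2 ^ \<rho>) sequentially"
    by real_asymp
  then have ev1: "eventually (\<lambda>\<rho>. N \<rho> \<le> 2 ^ \<rho>) sequentially"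
  proof eventually_elim
    case (elim \<rho>)
    then have "real (N \<rho>) \<le> real (2 ^ \<rho>)" by (simp add: N_def)
    then show ?case unfolding of_nat_le_iff .
  qed
  \<comment> \<open>The added 1 absorbs the summand 1 in
    \<open>m = s * K * b (R n) + 1\<close>.\<close>
  define C' where "C' = real (s * K * (2 ^ (D + 1) * C)) + 1"
  have ev2: "eventually (\<lambda>n::nat. (C' * 2 ^ A') * real n powr (real A' / real A) \<le> real n powr (1/2 + \<epsilon>)) sequentially"
    using exp by real_asymp
  have "eventually (\<lambda>n. N (R n) \<le> 2 ^ R n) sequentially"
    using eventually_compose_filterlim[OF ev1 R_top] .
  then show ?thesis
    using ev2 eventually_gt_at_top[of 0]
  proof eventually_elim
    case (elim n)
    define x where "x = real n powr (1 / real A)"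
    have x: "x \<ge> 1" using elim(3) by (simp add: x_def ge_one_powr_ge_zero)
    have R1: "real (R n) \<ge> x" "real (R n) \<le> 2 * x"
      using x unfolding R_def x_def[symmetric] by linarith+
    then have "R n > 0" using x by linarith
    have "real n = x ^ A"
      using elim(3) \<open>A > 0\<close> by (simp add: x_def powr_power)
    also have "\<dots> \<le> real (R n) ^ A" using R1(1) x by (intro power_mono) auto
    also have "\<dots> \<le> real C * real (R n) ^ A"
      using \<open>C > 0\<close> mult_right_mono[of 1 "real C" "real (R n) ^ A"] by simp
    also have "\<dots> = real (N (R n))" by (simp add: N_def)
    finally have nN: "n \<le> N (R n)" by simp
    define m where "m = s * K * b (R n) + 1"
    have "real m \<le> C' * real (R n) ^ A'"
    proof -
      have "1 \<le> real (R n) ^ A'" using \<open>R n > 0\<close> by (intro one_le_power) simp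
      then show ?thesis
        unfolding m_def b_def C'_def by (simp add: algebra_simps)
    qed
    also have "\<dots> \<le> C' * (2 * x) ^ A'"
      using R1(2) by (intro mult_left_mono power_mono) (auto simp: C'_def)
    also have "\<dots> = (C' * 2 ^ A') * real n powr (real A' / real A)"
      using elim(3) by (simp add: x_def power_mult_distrib powr_power)
    also have "\<dots> \<le> real n powr (1/2 + \<epsilon>)" by (rule elim(2))
    finally have m_le: "real m \<le> real n powr (1/2 + \<epsilon>)" .
    have "N (R n) ^ m * s ^ (K * R n * b (R n)) * (s - 1) ^ (K * R n * m) < s ^ (K * R n * m)"
      by (rule block_graph_count[OF K(2) elim(1) m_def \<open>s \<ge> 2\<close> K(1) \<open>R n > 0\<close>])
    from paraboloid_graph_exists[OF chi _ N_eq b_eq this] \<open>s \<ge> 2\<close>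
    obtain V :: "((nat \<Rightarrow> int) \<times> (nat \<Rightarrow> int) \<times> int) set" and E c where
      V: "finite V" "card V = N (R n)" "E \<subseteq> [V]\<^bsup>2\<^esup>" "triangle_colouring J V E c" "K_free_bound s V E m"
      by auto
    from graph_restrict_to_nat[OF V(3-5,1)] nN V(2) m_le show ?case by metis
  qed
qed

section \<open>The cube-root construction\<close>

text \<open>The quotient \<open>T ^ T / fact T\<close> is one term of the exponential series at
  \<open>T\<close>, hence at most \<open>exp 1 ^ T\<close>.\<close>

lemma choose_le_power_3:
  assumes "T > 0"
  shows "real (n choose T) \<le> (3 * real n / real T) ^ T"
proof -
  have "real T ^ T / fact T \<le> exp (real T)"
    using exp_converges[of "real T"] summable_exp[of "real T"]
    unfolding exp_def by (intro order_trans[OF _ sum_le_suminf[of _ "{T}"]]) (auto simp: scaleR_conv_of_real divide_inverse mult.commute)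
  also have "exp (real T) = exp 1 ^ T" by (simp flip: exp_of_nat_mult)
  also have "\<dots> \<le> 3 ^ T" using exp_le by (intro power_mono) auto
  finally have "real T ^ T \<le> 3 ^ T * fact T" by (simp add: field_simps)
  then have "real (n choose T) * real T ^ T \<le> real (n choose T) * (3 ^ T * fact T)"
    by (intro mult_left_mono) auto
  also have "\<dots> = 3 ^ T * real ((n choose T) * fact T)" by (simp add: mult_ac)
  also have "\<dots> \<le> 3 ^ T * real (n ^ T)"
    by (intro mult_left_mono) (auto simp del: of_nat_mult of_nat_power simp add: binomial_fact_pow)
  finally show ?thesis
    using assms by (simp add: power_divide power_mult_distrib field_simps)
qed

text \<open>The third hypothesis makes the choice of \<open>X\<close> together with its probability
  at most \<open>2 ^ - T\<close>; the fourth bounds the number of pairs of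
  \<open>\<alpha>\<close>-sets by less than \<open>2 ^ T\<close>.\<close>

lemma scattered_count:
  fixes n N \<alpha> T :: nat
  assumes "T > 0" "N > 0" "6 * real n * (real \<alpha>)\<^sup>2 \<le> real T * (real N)\<^sup>2" "2 * real \<alpha> * log 2 (real N) < real T"
    and "\<alpha> \<le> N"
  shows "(n choose T) * (N choose \<alpha>)\<^sup>2 * (\<alpha>\<^sup>2) ^ T < (N\<^sup>2) ^ T"
proof -
  have "(N choose \<alpha>)\<^sup>2 \<le> (N ^ \<alpha>)\<^sup>2"
    using card_nsets_le_power[of "{..<N}" \<alpha>] by (intro power_mono) simp_all
  then have "real ((N choose \<alpha>)\<^sup>2) \<le> real N ^ (2 * \<alpha>)"
    by (simp only: power_mult[symmetric] of_nat_power[symmetric] of_nat_le_iff mult.commute[of \<alpha>])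
  also have "\<dots> = (2 powr log 2 (real N)) ^ (2 * \<alpha>)" using assms(2) by simp
  also have "\<dots> = 2 powr (2 * real \<alpha> * log 2 (real N))"
    by (simp add: powr_power mult_ac)
  also have "\<dots> < 2 powr real T" using assms(4) by simp
  finally have 1: "real ((N choose \<alpha>)\<^sup>2) < 2 ^ T" by (simp add: powr_realpow)
  have "real (n choose T) * ((real \<alpha>)\<^sup>2) ^ T \<le> (3 * real n / real T) ^ T * ((real \<alpha>)\<^sup>2) ^ T"
    by (intro mult_right_mono choose_le_power_3 assms(1)) auto
  also have "\<dots> = (3 * real n * (real \<alpha>)\<^sup>2 / real T) ^ T"
    by (simp add: power_mult_distrib power_divide)
  also have "\<dots> \<le> ((real N)\<^sup>2 / 2) ^ T"
    using assms(1,3) by (intro power_mono) (auto simp: field_simps)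
  finally have 2: "real (n choose T) * ((real \<alpha>)\<^sup>2) ^ T \<le> ((real N)\<^sup>2 / 2) ^ T" .
  have "real ((n choose T) * (N choose \<alpha>)\<^sup>2 * (\<alpha>\<^sup>2) ^ T) = (real (n choose T) * ((real \<alpha>)\<^sup>2) ^ T) * real ((N choose \<alpha>)\<^sup>2)"
    by simp
  also have "\<dots> \<le> ((real N)\<^sup>2 / 2) ^ T * real ((N choose \<alpha>)\<^sup>2)"
    using 2 by (intro mult_right_mono) auto
  also have "\<dots> < ((real N)\<^sup>2 / 2) ^ T * 2 ^ T"
    using 1 assms(2) by (intro mult_strict_left_mono) auto
  also have "\<dots> = real ((N\<^sup>2) ^ T)"
    by (simp add: power_divide)
  finally show ?thesis unfolding of_nat_less_iff .
qed

text \<open>With \<open>N\<close> about \<open>n powr (2/3)\<close> and \<open>\<alpha>\<close>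
  about \<open>N powr (1/2)\<close>, a product of two \<open>\<alpha>\<close>-sets receives about
  \<open>n * \<alpha>\<^sup>2 / N\<^sup>2\<close> vertices. This and \<open>\<alpha>\<close> itself
  are both about the cube root of \<open>n\<close>, which balances the two requirements on
  \<open>T\<close>.\<close>

lemma cube_root_upper_bound:
  assumes base: "\<And>\<epsilon>. \<epsilon> > 0 \<Longrightarrow> \<forall>\<^sub>F n in sequentially. \<exists>E c m. E \<subseteq> [{..<n}]\<^bsup>2\<^esup> \<and> triangle_colouring {..<t} {..<n} E c \<and>
    K_free_bound s {..<n} E m \<and> real m \<le> real n powr (1/2 + \<epsilon>)"
    and "\<epsilon> > 0"
  shows "\<forall>\<^sub>F n in sequentially. \<exists>E c m. E \<subseteq> [{..<n}]\<^bsup>2\<^esup> \<and> triangle_colouring {..<t + t} {..<n} E c \<and>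
    K_free_bound s {..<n} E m \<and> real m \<le> real n powr (1/3 + \<epsilon>)"
proof -
  \<comment> \<open>The losses caused by \<open>e\<close> are \<open>n powr (4 * e / 3)\<close> in
    the expected size and \<open>n powr (2 * e / 3)\<close> in \<open>\<alpha>\<close>; both stay
    below \<open>n powr (3 * e)\<close>, with room for constants and the logarithm.\<close>
  define e where "e = \<epsilon> / 3"
  have "e > 0" and \<epsilon>: "\<epsilon> = 3 * e" using \<open>\<epsilon> > 0\<close> by (simp_all add: e_def)
  have top: "filterlim (\<lambda>n::nat. nat \<lceil>real n powr (2/3)\<rceil>) at_top sequentially"
    by real_asymp
  note ev = eventually_compose_filterlim[OF base[OF \<open>e > 0\<close>] top]
  \<comment> \<open>These estimates give the hypotheses of \<open>scattered_count\<close> after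
    rounding, which yields \<open>N \<le> 2 * x\<close> and \<open>T \<ge> y / 2\<close>.\<close>
  have ev1: "\<forall>\<^sub>F n::nat in sequentially. 6 * real n * (2 * real n powr (2/3)) powr (2 * e) \<le>
      (real n powr (1/3 + 3*e) / 2) * real n powr (2/3)"
    using \<open>e > 0\<close> by real_asymp
  have ev2: "\<forall>\<^sub>F n::nat in sequentially. 2 * (2 * real n powr (2/3)) powr (1/2+e) * log 2 (2 * real n powr (2/3)) <
      real n powr (1/3 + 3*e) / 2"
    using \<open>e > 0\<close> by real_asymp
  have ev3: "\<forall>\<^sub>F n::nat in sequentially. 2 \<le> real n powr (1/3 + 3*e)"
    using \<open>e > 0\<close> by real_asymp
  show ?thesis
    using ev ev1 ev2 ev3 eventually_gt_at_top[of 0]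
  proof eventually_elim
    case (elim n)
    define x where "x = real n powr (2/3)"
    define N where "N = nat \<lceil>x\<rceil>"
    define y where "y = real n powr (1/3 + 3 * e)"
    define T where "T = nat \<lfloor>y\<rfloor>"
    obtain E c \<alpha>' where E: "E \<subseteq> [{..<N}]\<^bsup>2\<^esup>" "triangle_colouring {..<t} {..<N} E c"
      "K_free_bound s {..<N} E \<alpha>'" "real \<alpha>' \<le> real N powr (1/2 + e)"
      using elim(1) unfolding N_def x_def by blast
    \<comment> \<open>The cap at \<open>N\<close> lets subsets of exactly \<open>\<alpha>\<close>
      vertices exist; it is harmless because no set of vertices exceeds \<open>N\<close>.\<close>
    define \<alpha> where "\<alpha> = min \<alpha>' N"
    have E3: "K_free_bound s {..<N} E \<alpha>"
    proof (rule K_free_boundI)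
      fix X assume "X \<subseteq> {..<N}" "K_free s X E"
      then show "card X \<le> \<alpha>"
        using K_free_boundD[OF E(3)] card_mono[of "{..<N}" X] unfolding \<alpha>_def by simp
    qed
    have x: "x \<ge> 1" using elim(5) by (simp add: x_def ge_one_powr_ge_zero)
    have N: "real N \<ge> x" "real N \<le> 2 * x" "N > 0"
      using x unfolding N_def by linarith+
    have T: "real T \<le> y" "real T \<ge> y / 2" "T > 0"
      using elim(4) unfolding T_def y_def[symmetric] by linarith+
    have \<alpha>: "real \<alpha> \<le> real N powr (1/2 + e)" using E(4) unfolding \<alpha>_def by linarith
    have "6 * real n * (real \<alpha>)\<^sup>2 \<le> real T * (real N)\<^sup>2"
    proof -
      have "(real \<alpha>)\<^sup>2 \<le> (real N powr (1/2 + e))\<^sup>2" using \<alpha> by (intro power_mono) auto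
      also have "\<dots> = real N * real N powr (2 * e)"
        using N(3) by (simp add: power2_eq_square powr_add[symmetric] powr_mult_base)
      also have "\<dots> \<le> real N * (2 * x) powr (2 * e)"
        using N(2) \<open>e > 0\<close> by (intro mult_left_mono powr_mono2) auto
      finally have "6 * real n * (real \<alpha>)\<^sup>2 \<le> 6 * real n * (real N * (2 * x) powr (2 * e))"
        by (intro mult_left_mono) auto
      also have "\<dots> = real N * (6 * real n * (2 * x) powr (2 * e))" by simp
      also have "\<dots> \<le> real N * ((y / 2) * x)"
        using elim(2) unfolding x_def y_def by (intro mult_left_mono) auto
      also have "\<dots> \<le> real N * (real T * real N)"
        using N T x by (intro mult_left_mono mult_mono) auto
      finally show ?thesis by (simp add: power2_eq_square mult_ac)
    qed
    moreover have "2 * real \<alpha> * log 2 (real N) < real T"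
    proof -
      have "real \<alpha> \<le> (2 * x) powr (1/2 + e)"
        using \<alpha> N(2) \<open>e > 0\<close> by (elim order_trans) (intro powr_mono2, auto)
      moreover have "log 2 (real N) \<le> log 2 (2 * x)" "0 \<le> log 2 (real N)"
        using N by auto
      ultimately have "2 * real \<alpha> * log 2 (real N) \<le> 2 * (2 * x) powr (1/2 + e) * log 2 (2 * x)"
        by (intro mult_mono) auto
      also have "\<dots> < y / 2" using elim(3) unfolding x_def y_def .
      also have "\<dots> \<le> real T" by (rule T(2))
      finally show ?thesis .
    qed
    ultimately have count: "(n choose T) * (N choose \<alpha>)\<^sup>2 * (\<alpha>\<^sup>2) ^ T < (N\<^sup>2) ^ T"
      using T(3) N(3) by (intro scattered_count) (auto simp: \<alpha>_def)
    have "\<exists>F d. F \<subseteq> [{..<n}]\<^bsup>2\<^esup> \<and> triangle_colouring {..<t + t} {..<n} F d \<and> K_free_bound s {..<n} F T"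
      by (rule product_graph_exists[OF E(1,2) E3])
        (use count N(3) in \<open>auto simp: \<alpha>_def lessThan_empty_iff\<close>)
    then show ?case
      using T(1) unfolding y_def \<epsilon> by blast
  qed
qed

subsection \<open>Lower bounds for three and four colours\<close>

lemma card_UN_le_mult:
  assumes "finite A" "card A \<le> p" "\<And>a. a \<in> A \<Longrightarrow> card (B a) \<le> q"
  shows "card (\<Union>a\<in>A. B a) \<le> p * q"
proof -
  have "card (\<Union>a\<in>A. B a) \<le> (\<Sum>a\<in>A. card (B a))" by (rule card_UN_le[OF assms(1)])
  also have "\<dots> \<le> card A * q" using sum_bounded_above[of A "\<lambda>a. card (B a)" q] assms(3) by simp
  also have "\<dots> \<le> p * q" using assms(2) by (rule mult_le_mono1)
  finally show ?thesis .
qed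

section \<open>Independent sets in sparse uniform hypergraphs\<close>

text \<open>Averaging over all maps \<open>V \<rightarrow> {..<q}\<close>: a fixed
  \<open>k\<close>-edge is monochromatic with probability \<open>1 / q ^ (k - 1)\<close>.\<close>

lemma exists_few_monochromatic_edges:
  fixes q :: nat
  assumes "finite V" "H \<subseteq> [V]\<^bsup>k\<^esup>" "q > 0" "k > 0"
  shows "\<exists>f\<in>V \<rightarrow> {..<q}. q ^ (k - 1) * card {e \<in> H. \<exists>a<q. \<forall>v\<in>e. f v = a} \<le> card H"
proof (rule ccontr)
  assume "\<not> ?thesis"
  then have bad: "card H + 1 \<le> q ^ (k - 1) * card {e \<in> H. \<exists>a<q. \<forall>v\<in>e. f v = a}" if "f \<in> V \<rightarrow> {..<q}" for f
    using that by (simp add: not_le Suc_le_eq)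
  let ?F = "V \<rightarrow>\<^sub>E {..<q}"
  have finH: "finite H" using assms(1,2) finite_imp_finite_nsets finite_subset by blast
  have finF: "finite ?F" using assms(1) by (simp add: finite_PiE)
  have cardF: "card ?F = q ^ card V" using assms(1) by (simp add: card_funcsetE)
  have edge: "q ^ (k - 1) * card {f \<in> ?F. \<exists>a<q. \<forall>v\<in>e. f v = a} \<le> q ^ card V" if "e \<in> H" for e
  proof -
    have e: "e \<subseteq> V" "card e = k" using that assms(2) by (auto simp: nsets_def)
    have "k \<le> card V" using card_mono[OF assms(1) e(1)] e(2) by simp
    have "{f \<in> ?F. \<exists>a<q. \<forall>v\<in>e. f v = a} \<subseteq> (\<Union>a\<in>{..<q}. PiE V (\<lambda>v. if v \<in> e then {a} else {..<q}))"
      by (auto simp: PiE_iff)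
    then have "card {f \<in> ?F. \<exists>a<q. \<forall>v\<in>e. f v = a} \<le> card (\<Union>a\<in>{..<q}. PiE V (\<lambda>v. if v \<in> e then {a} else {..<q}))"
      using assms(1) by (intro card_mono finite_UN_I finite_PiE) auto
    also have "\<dots> \<le> q * q ^ (card V - k)"
      by (intro card_UN_le_mult) (simp_all add: card_PiE_restricted[OF assms(1) e(1)] e(2))
    finally have "q ^ (k - 1) * card {f \<in> ?F. \<exists>a<q. \<forall>v\<in>e. f v = a} \<le> q ^ (k - 1) * (q * q ^ (card V - k))"
      by (rule mult_le_mono2)
    also have "\<dots> = q ^ ((k - 1) + 1 + (card V - k))" by (simp add: power_add)
    also have "(k - 1) + 1 + (card V - k) = card V" using \<open>k \<le> card V\<close> \<open>k > 0\<close> by simp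
    finally show ?thesis .
  qed
  have "card ?F * (card H + 1) = (\<Sum>f\<in>?F. card H + 1)" by simp
  also have "\<dots> \<le> (\<Sum>f\<in>?F. q ^ (k - 1) * card {e \<in> H. \<exists>a<q. \<forall>v\<in>e. f v = a})"
    by (intro sum_mono bad) (simp add: PiE_def)
  also have "\<dots> = q ^ (k - 1) * (\<Sum>f\<in>?F. card {e \<in> H. \<exists>a<q. \<forall>v\<in>e. f v = a})"
    by (simp add: sum_distrib_left)
  also have "(\<Sum>f\<in>?F. card {e \<in> H. \<exists>a<q. \<forall>v\<in>e. f v = a}) = (\<Sum>e\<in>H. card {f \<in> ?F. \<exists>a<q. \<forall>v\<in>e. f v = a})"
    by (rule sum_multicount_gen[OF finF finH]) simp
  also have "q ^ (k - 1) * (\<Sum>e\<in>H. card {f \<in> ?F. \<exists>a<q. \<forall>v\<in>e. f v = a}) \<le> (\<Sum>e\<in>H. q ^ card V)"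
    unfolding sum_distrib_left by (intro sum_mono edge)
  also have "\<dots> = card ?F * card H" by (simp add: cardF)
  finally have "card ?F = 0" by simp
  then show False using cardF \<open>q > 0\<close> by simp
qed

text \<open>Deleting a vertex from each monochromatic edge costs at most half of \<open>V\<close>.
  Every remaining colour class is then independent, and the largest contains at least a
  \<open>q\<close>-th part of what is left.\<close>

lemma hypergraph_independent_set_nat:
  fixes q :: nat
  assumes "finite V" "H \<subseteq> [V]\<^bsup>k\<^esup>" "q > 0" "k > 0" "2 * card H \<le> q ^ (k - 1) * card V"
  shows "\<exists>X\<subseteq>V. (\<forall>e\<in>H. \<not> e \<subseteq> X) \<and> card V \<le> 2 * q * card X"
proof -
  obtain f where f: "f \<in> V \<rightarrow> {..<q}" "q ^ (k - 1) * card {e \<in> H. \<exists>a<q. \<forall>v\<in>e. f v = a} \<le> card H"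
    using exists_few_monochromatic_edges[OF assms(1-4)] by (rule bexE)
  define M where "M = {e \<in> H. \<exists>a<q. \<forall>v\<in>e. f v = a}"
  have finH: "finite H" using assms(1,2) finite_imp_finite_nsets finite_subset by blast
  then have finM: "finite M" by (simp add: M_def)
  have "q ^ (k - 1) * (2 * card M) \<le> q ^ (k - 1) * card V"
    unfolding mult.left_commute[of _ 2]
    using order_trans[OF mult_le_mono2[OF f(2)[folded M_def], of 2] assms(5)] .
  then have M: "2 * card M \<le> card V" using \<open>q > 0\<close> by simp
  \<comment> \<open>one vertex of each monochromatic edge is deleted\<close>
  define w where "w = (\<lambda>e :: 'a set. SOME v. v \<in> e)"
  have w: "w e \<in> e" if "e \<in> H" for e
  proof -
    have "card e = k" using that assms(2) by (auto simp: nsets_def)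
    then have "e \<noteq> {}" using assms(4) by auto
    then show ?thesis unfolding w_def by (simp add: some_in_eq)
  qed
  define W where "W = V - w ` M"
  have "card V \<le> card W + card (w ` M)"
    using assms(1) finM unfolding W_def by (metis diff_card_le_card_Diff finite_imageI le_diff_conv)
  then have W: "card V \<le> 2 * card W"
    using M card_image_le[OF finM, of w] by simp
  define X where "X = (\<lambda>a. {v \<in> W. f v = a})"
  have "\<exists>a<q. card W \<le> q * card (X a)"
  proof (rule ccontr)
    assume "\<not> ?thesis"
    then have lt: "q * card (X a) < card W" if "a \<in> {..<q}" for a using that by auto
    have "W = (\<Union>a\<in>{..<q}. X a)" using f(1) unfolding X_def W_def by auto
    then have "q * card W = q * card (\<Union>a\<in>{..<q}. X a)" by simp
    also have "\<dots> \<le> q * (\<Sum>a<q. card (X a))"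
      by (intro mult_le_mono2 card_UN_le) simp
    also have "\<dots> = (\<Sum>a<q. q * card (X a))" by (simp add: sum_distrib_left)
    also have "\<dots> < (\<Sum>a<q. card W)"
      using lt \<open>q > 0\<close> by (intro sum_strict_mono) auto
    finally show False by simp
  qed
  then obtain a where a: "a < q" "card W \<le> q * card (X a)" by blast
  have "\<not> e \<subseteq> X a" if "e \<in> H" for e
  proof
    assume "e \<subseteq> X a"
    then have "e \<in> M" using that a(1) unfolding M_def X_def by auto
    then have "w e \<notin> W" unfolding W_def by simp
    with w[OF that] \<open>e \<subseteq> X a\<close> show False unfolding X_def by auto
  qed
  moreover have "X a \<subseteq> V" unfolding X_def W_def by auto
  ultimately show ?thesis using W a(2) by (intro exI[of _ "X a"]) auto
qed

lemma hypergraph_independent_set: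
  fixes y :: real
  assumes "finite V" "H \<subseteq> [V]\<^bsup>k\<^esup>" "y \<ge> 1" "k > 0" "2 * real (card H) \<le> y ^ (k - 1) * real (card V)"
  shows "\<exists>X\<subseteq>V. (\<forall>e\<in>H. \<not> e \<subseteq> X) \<and> real (card V) \<le> 4 * y * real (card X)"
proof -
  define q where "q = nat \<lceil>y\<rceil>"
  have q: "real q \<ge> y" "real q \<le> 2 * y" "q > 0"
    using assms(3) unfolding q_def by linarith+
  have "2 * real (card H) \<le> real q ^ (k - 1) * real (card V)"
    using assms(3,5) q(1) by (elim order_trans) (intro mult_right_mono power_mono, auto)
  then have "real (2 * card H) \<le> real (q ^ (k - 1) * card V)" by simp
  then have "2 * card H \<le> q ^ (k - 1) * card V" unfolding of_nat_le_iff .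
  from hypergraph_independent_set_nat[OF assms(1,2) q(3) assms(4) this] obtain X
    where X: "X \<subseteq> V" "\<forall>e\<in>H. \<not> e \<subseteq> X" "card V \<le> 2 * q * card X" by (elim exE conjE)
  have "real (card V) \<le> real (2 * q * card X)" using X(3) unfolding of_nat_le_iff .
  also have "\<dots> \<le> 4 * y * real (card X)"
    using q(2) mult_right_mono[OF q(2), of "2 * real (card X)"] by simp
  finally show ?thesis using X(1,2) by blast
qed

section \<open>Counting copies of the complete graph on five vertices\<close>

definition two_coloured_extensions :: "'a set \<Rightarrow> 'a set set \<Rightarrow> ('a set \<Rightarrow> nat) \<Rightarrow> nat set \<Rightarrow> 'a set \<Rightarrow> 'a set" where
  "two_coloured_extensions V E c J S =
     (\<Union>a\<in>S. \<Union>b\<in>S. \<Union>i\<in>J. \<Union>j\<in>J - {i}. V \<inter> colour_nbhd E c i a \<inter> colour_nbhd E c j b)"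

lemma two_coloured_extensionsI:
  assumes "triangle_colouring J V E c" "a \<in> S" "b \<in> S" "S \<subseteq> V" "z \<in> V" "z \<notin> S"
    "{z, a} \<in> E" "{z, b} \<in> E" "c {z, a} \<noteq> c {z, b}"
  shows "z \<in> two_coloured_extensions V E c J S"
proof -
  have "z \<noteq> a" "z \<noteq> b" "a \<in> V" "b \<in> V" using assms by auto
  then have "c {z, a} \<in> J" "c {z, b} \<in> J - {c {z, a}}"
    using triangle_colouring_mem[OF assms(1)] assms by auto
  moreover have "z \<in> V \<inter> colour_nbhd E c (c {z, a}) a \<inter> colour_nbhd E c (c {z, b}) b"
    using assms \<open>z \<noteq> a\<close> \<open>z \<noteq> b\<close> by (simp add: colour_nbhd_def insert_commute)
  ultimately show ?thesis
    unfolding two_coloured_extensions_def using assms(2,3) by blast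
qed

text \<open>The constant 16 counts the pairs of endpoints in \<open>S\<close>, which has at most
  four elements.\<close>

lemma card_two_coloured_extensions:
  assumes "finite V" "finite J" "S \<subseteq> V" "card S \<le> 4" "finite S"
    "\<And>a b i j. a \<in> V \<Longrightarrow> b \<in> V \<Longrightarrow> i \<in> J \<Longrightarrow> j \<in> J \<Longrightarrow> i \<noteq> j \<Longrightarrow>
       card (V \<inter> colour_nbhd E c i a \<inter> colour_nbhd E c j b) \<le> Q"
  shows "card (two_coloured_extensions V E c J S) \<le> 16 * (card J)\<^sup>2 * Q"
proof -
  have "card (two_coloured_extensions V E c J S) \<le> 4 * (4 * (card J * (card J * Q)))"
    unfolding two_coloured_extensions_def
  proof (intro card_UN_le_mult)
    fix i show "card (J - {i}) \<le> card J" using assms(2) by (intro card_mono) auto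
  next
    fix a b i j assume "a \<in> S" "b \<in> S" "i \<in> J" "j \<in> J - {i}"
    then show "card (V \<inter> colour_nbhd E c i a \<inter> colour_nbhd E c j b) \<le> Q"
      using assms(3) by (intro assms(6)) auto
  qed (use assms(2,4,5) in simp_all)
  then show ?thesis by (simp add: power2_eq_square mult_ac)
qed

lemma finite_two_coloured_extensions: "finite V \<Longrightarrow> finite (two_coloured_extensions V E c J S)"
  by (rule finite_subset[of _ V]) (auto simp: two_coloured_extensions_def)

lemma two_coloured_extensions_subset: "two_coloured_extensions V E c J S \<subseteq> V"
  by (auto simp: two_coloured_extensions_def)

text \<open>A triangle inside the clique is not monochromatic. If one corner sees a single colour on
  its two sides, the third side has a different colour, so another corner sees two.\<close>

lemma clique_two_coloured_vertex:
  assumes "triangle_colouring J V E c" "K \<subseteq> V" "clique K E" "card K \<ge> 3"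
  shows "\<exists>z\<in>K. z \<in> two_coloured_extensions V E c J (K - {z})"
proof -
  obtain T where "T \<subseteq> K" "card T = 3" using assms(4) obtain_subset_with_card_n by blast
  then obtain x y w where xyw: "x \<in> K" "y \<in> K" "w \<in> K" "x \<noteq> y" "y \<noteq> w" "x \<noteq> w"
    unfolding card_3_iff by auto
  have E: "{u, v} \<in> E" if "u \<in> K" "v \<in> K" "u \<noteq> v" for u v
    using assms(3) that unfolding clique_def by simp
  have ext: "z \<in> two_coloured_extensions V E c J (K - {z})"
    if "z \<in> K" "a \<in> K" "b \<in> K" "z \<noteq> a" "z \<noteq> b" "c {z, a} \<noteq> c {z, b}" for z a b
    using that assms(2) E by (intro two_coloured_extensionsI[OF assms(1), of a _ b]) auto
  show ?thesis
  proof (cases "c {x, y} = c {x, w}")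
    case False
    then show ?thesis using ext[of x y w] xyw by blast
  next
    case True
    have "c {y, x} \<noteq> c {y, w}"
    proof
      assume "c {y, x} = c {y, w}"
      then show False
        using True xyw E assms(2)
        by (intro triangle_colouring_no_triangle[OF assms(1), of x y w "c {x, y}"]) (auto simp: insert_commute)
    qed
    then show ?thesis using ext[of y x w] xyw by auto
  qed
qed

text \<open>Three vertices are peeled off, each seeing two colours towards the vertices that remain,
  until an edge is left. Read backwards, this gives \<open>card V * (card J * d)\<close> choices of
  an ordered edge and at most \<open>16 * (card J)\<^sup>2 * Q\<close> choices for each further
  vertex.\<close>

lemma card_K5_le:
  assumes "triangle_colouring J V E c" "finite V" "finite J"
    and Q: "\<And>a b i j. a \<in> V \<Longrightarrow> b \<in> V \<Longrightarrow> i \<in> J \<Longrightarrow> j \<in> J \<Longrightarrow> i \<noteq> j \<Longrightarrow>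
       card (V \<inter> colour_nbhd E c i a \<inter> colour_nbhd E c j b) \<le> Q"
    and deg: "\<And>a i. a \<in> V \<Longrightarrow> i \<in> J \<Longrightarrow> card (V \<inter> colour_nbhd E c i a) \<le> d"
  shows "card {e \<in> [V]\<^bsup>5\<^esup>. clique e E} \<le> card V * (card J * d) * (16 * (card J)\<^sup>2 * Q) ^ 3"
proof -
  let ?X = "two_coloured_extensions V E c J" and ?L = "16 * (card J)\<^sup>2 * Q"
  let ?N = "\<lambda>u. \<Union>i\<in>J. V \<inter> colour_nbhd E c i u"
  have sub: "{e \<in> [V]\<^bsup>5\<^esup>. clique e E} \<subseteq>
    (\<Union>u\<in>V. \<Union>v\<in>?N u. \<Union>x\<in>?X {u, v}. \<Union>y\<in>?X {u, v, x}. \<Union>z\<in>?X {u, v, x, y}. {{u, v, x, y, z}})"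
  proof
    fix e assume "e \<in> {e \<in> [V]\<^bsup>5\<^esup>. clique e E}"
    then have e: "e \<subseteq> V" "finite e" "card e = 5" "clique e E" by (auto simp: nsets_def)
    obtain z where z: "z \<in> e" "z \<in> ?X (e - {z})"
      using clique_two_coloured_vertex[OF assms(1) e(1,4)] e(3) by auto
    have e4: "e - {z} \<subseteq> V" "clique (e - {z}) E" "card (e - {z}) = 4"
      using e z(1) by (auto intro: smaller_clique)
    obtain y where y: "y \<in> e - {z}" "y \<in> ?X (e - {z} - {y})"
      using clique_two_coloured_vertex[OF assms(1) e4(1,2)] e4(3) by auto
    have e3: "e - {z} - {y} \<subseteq> V" "clique (e - {z} - {y}) E" "card (e - {z} - {y}) = 3"
      using e4 y(1) by (auto intro: smaller_clique)
    obtain x where x: "x \<in> e - {z} - {y}" "x \<in> ?X (e - {z} - {y} - {x})"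
      using clique_two_coloured_vertex[OF assms(1) e3(1,2)] e3(3) by auto
    have "card (e - {z} - {y} - {x}) = 2" using e3 x(1) by simp
    then obtain u v where uv: "e - {z} - {y} - {x} = {u, v}" "u \<noteq> v" unfolding card_2_iff by blast
    have e3': "e - {z} - {y} = {u, v, x}" using uv(1) x(1) by blast
    have e4': "e - {z} = {u, v, x, y}" using e3' y(1) by blast
    have e': "e = {u, v, x, y, z}" using e4' z(1) by blast
    have "u \<in> V" "v \<in> V" "{u, v} \<in> E" using e(1,4) uv(2) unfolding e' clique_def by auto
    then have "v \<in> ?N u"
      using triangle_colouring_mem[OF assms(1) _ _ uv(2)] uv(2) by (auto simp: colour_nbhd_def)
    with \<open>u \<in> V\<close> x(2)[unfolded uv(1)] y(2)[unfolded e3'] z(2)[unfolded e4']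
    show "e \<in> (\<Union>u\<in>V. \<Union>v\<in>?N u. \<Union>x\<in>?X {u, v}. \<Union>y\<in>?X {u, v, x}. \<Union>z\<in>?X {u, v, x, y}. {{u, v, x, y, z}})"
      unfolding e' by blast
  qed
  have X: "card (?X S) \<le> ?L" if "S \<subseteq> V" "card S \<le> 4" "finite S" for S
    using card_two_coloured_extensions[OF assms(2,3) that Q] .
  have mem: "v \<in> V" if "v \<in> ?X S" for v S
    by (rule subsetD[OF two_coloured_extensions_subset that])
  have "card (\<Union>u\<in>V. \<Union>v\<in>?N u. \<Union>x\<in>?X {u, v}. \<Union>y\<in>?X {u, v, x}. \<Union>z\<in>?X {u, v, x, y}. {{u, v, x, y, z}})
      \<le> card V * ((card J * d) * (?L * (?L * (?L * 1))))"
  proof (intro card_UN_le_mult)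
    fix u assume u: "u \<in> V"
    show "card (V \<inter> colour_nbhd E c i u) \<le> d" if "i \<in> J" for i using deg[OF u that] .
    show "finite (?N u)" using assms(2,3) by auto
    fix v assume "v \<in> ?N u"
    then have v: "v \<in> V" by auto
    show "card (?X {u, v}) \<le> ?L" using u v by (intro X) (auto simp: card_insert_if)
    fix x assume "x \<in> ?X {u, v}"
    then have x: "x \<in> V" by (rule mem)
    show "card (?X {u, v, x}) \<le> ?L" using u v x by (intro X) (auto simp: card_insert_if)
    fix y assume "y \<in> ?X {u, v, x}"
    then have y: "y \<in> V" by (rule mem)
    show "card (?X {u, v, x, y}) \<le> ?L" using u v x y by (intro X) (auto simp: card_insert_if)
  qed (simp_all add: assms(2,3) finite_two_coloured_extensions)
  moreover have "finite (\<Union>u\<in>V. \<Union>v\<in>?N u. \<Union>x\<in>?X {u, v}. \<Union>y\<in>?X {u, v, x}. \<Union>z\<in>?X {u, v, x, y}. {{u, v, x, y, z}})"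
    using assms(2,3) by (intro finite_UN_I finite_two_coloured_extensions) auto
  ultimately have "card {e \<in> [V]\<^bsup>5\<^esup>. clique e E} \<le> card V * ((card J * d) * (?L * (?L * (?L * 1))))"
    using card_mono[OF _ sub] by (meson le_trans)
  then show ?thesis by (simp add: power3_eq_cube mult.assoc)
qed

text \<open>In a clique on five vertices, at most one edge at \<open>a\<close> has a colour other
  than \<open>i\<close>, since two would form a forbidden cherry. Among three
  \<open>i\<close>-neighbours of \<open>a\<close> the path \<open>x, y, z\<close> has an edge of
  colour \<open>i\<close>, which closes a triangle with \<open>a\<close>.\<close>

lemma K_free_5_of_no_cherry:
  assumes "triangle_colouring J V E c" "X \<subseteq> V"
    and cherry: "\<And>a b d. a \<in> X \<Longrightarrow> b \<in> X \<Longrightarrow> d \<in> X \<Longrightarrow> a \<noteq> b \<Longrightarrow> b \<noteq> d \<Longrightarrow> a \<noteq> d \<Longrightarrow>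
      {a, b} \<in> E \<Longrightarrow> {b, d} \<in> E \<Longrightarrow> {a, d} \<in> E \<Longrightarrow> c {a, b} = i \<or> c {b, d} = i"
  shows "K_free 5 X E"
  unfolding K_free_def
proof (rule notI, elim bexE)
  fix e assume "e \<in> [X]\<^bsup>5\<^esup>" and cl: "clique e E"
  then have e: "e \<subseteq> X" "finite e" "card e = 5" by (auto simp: nsets_def)
  then obtain a where a: "a \<in> e" by fastforce
  define N where "N = {w \<in> e - {a}. c {a, w} \<noteq> i}"
  have E: "{u, v} \<in> E" if "u \<in> e" "v \<in> e" "u \<noteq> v" for u v
    using cl that unfolding clique_def by simp
  have ch: "c {u, v} = i \<or> c {v, w} = i" if "u \<in> e" "v \<in> e" "w \<in> e" "u \<noteq> v" "v \<noteq> w" "u \<noteq> w" for u v w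
    using that e(1) E by (intro cherry) auto
  have "card N \<le> 1"
  proof (rule ccontr)
    assume "\<not> card N \<le> 1"
    then have "2 \<le> card N" by simp
    then obtain T where "T \<subseteq> N" "card T = 2" "finite T" by (rule obtain_subset_with_card_n)
    then obtain u v where uv: "u \<in> N" "v \<in> N" "u \<noteq> v" unfolding card_2_iff by auto
    then have "u \<in> e" "v \<in> e" "u \<noteq> a" "a \<noteq> v" "c {u, a} \<noteq> i" "c {a, v} \<noteq> i"
      by (auto simp: N_def insert_commute)
    then show False using ch[OF _ a] uv(3) by blast
  qed
  moreover have "card (e - {a} - N) = 4 - card N"
    using e a by (subst card_Diff_subset) (auto simp: N_def)
  ultimately have "3 \<le> card (e - {a} - N)" by simp
  then obtain T where "T \<subseteq> e - {a} - N" "card T = 3" "finite T" by (rule obtain_subset_with_card_n)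
  then obtain x y z where xyz: "x \<in> e - {a} - N" "y \<in> e - {a} - N" "z \<in> e - {a} - N" "x \<noteq> y" "y \<noteq> z" "x \<noteq> z"
    unfolding card_3_iff by auto
  have no: False if "u \<in> e - {a} - N" "v \<in> e - {a} - N" "u \<noteq> v" "c {u, v} = i" for u v
  proof -
    have uv: "u \<in> e" "v \<in> e" "a \<noteq> u" "a \<noteq> v" "c {a, u} = i" "c {a, v} = i"
      using that(1,2) by (auto simp: N_def)
    then have V: "a \<in> V" "u \<in> V" "v \<in> V" using a e(1) assms(2) by auto
    show False
      by (rule triangle_colouring_no_triangle[OF assms(1) V uv(3) that(3) uv(4)
            E[OF a uv(1,3)] E[OF uv(1,2) that(3)] E[OF a uv(2,4)] uv(5) that(4) uv(6)])
  qed
  have "c {x, y} = i \<or> c {y, z} = i" using xyz by (intro ch) simp_all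
  then show False using no[of x y] no[of y z] xyz by (elim disjE) simp_all
qed

lemma card_pos_of_K_free_bound:
  assumes "K_free_bound s V E m" "finite V" "V \<noteq> {}" "s \<ge> 2"
  shows "m \<ge> 1"
proof -
  obtain v where "v \<in> V" using assms(3) by blast
  have "K_free 2 {v} E" by (simp add: K_free_2_iff)
  then have "K_free s {v} E" using assms(4) by (rule K_free_mono)
  then have "card {v} \<le> m" using \<open>v \<in> V\<close> by (intro K_free_boundD[OF assms(1)]) auto
  then show ?thesis by simp
qed

lemma triangle_colouring_two_nbhds:
  assumes "triangle_colouring J V E c" "a \<in> V" "b \<in> V"
  shows "triangle_colouring (J - {i} - {j}) (V \<inter> colour_nbhd E c i a \<inter> colour_nbhd E c j b) E c"
proof (rule triangle_colouringI)
  let ?U = "V \<inter> colour_nbhd E c i a \<inter> colour_nbhd E c j b"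
  show "c {x, y} \<in> J - {i} - {j}" if "x \<in> ?U" "y \<in> ?U" "x \<noteq> y" "{x, y} \<in> E" for x y
    using triangle_colouring_mem[OF triangle_colouring_colour_nbhd[OF assms(1,2), of i], of x y]
      triangle_colouring_mem[OF triangle_colouring_colour_nbhd[OF assms(1,3), of j], of x y] that by simp
  show False if "x \<in> ?U" "y \<in> ?U" "z \<in> ?U" "x \<noteq> y" "y \<noteq> z" "x \<noteq> z" "{x, y} \<in> E" "{y, z} \<in> E" "{x, z} \<in> E"
    "c {x, y} = k" "c {y, z} = k" "c {x, z} = k" for x y z k
    using triangle_colouring_no_triangle[OF assms(1) _ _ _ that(4-)] that(1-3) by simp
qed

text \<open>The 5-cliques form a 5-uniform hypergraph, whence the fourth power of \<open>y\<close>.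
  An independent set of this hypergraph is \<open>K_5\<close>-free and so has at most
  \<open>m\<close> elements.\<close>

lemma card_le_of_few_K5:
  assumes "triangle_colouring J V E c" "finite V" "finite J" "K_free_bound 5 V E m" "y \<ge> 1"
    and "\<And>a b i j. a \<in> V \<Longrightarrow> b \<in> V \<Longrightarrow> i \<in> J \<Longrightarrow> j \<in> J \<Longrightarrow> i \<noteq> j \<Longrightarrow>
       card (V \<inter> colour_nbhd E c i a \<inter> colour_nbhd E c j b) \<le> Q"
    and "\<And>a i. a \<in> V \<Longrightarrow> i \<in> J \<Longrightarrow> real (card (V \<inter> colour_nbhd E c i a)) \<le> d"
    and y: "2 * (real (card J) * d * (16 * (real (card J))\<^sup>2 * real Q) ^ 3) \<le> y ^ 4"
  shows "real (card V) \<le> 4 * y * real m"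
proof (cases "V = {} \<or> J = {}")
  case False
  let ?H = "{e \<in> [V]\<^bsup>5\<^esup>. clique e E}"
  define d' where "d' = nat \<lfloor>d\<rfloor>"
  \<comment> \<open>The sign of \<open>d\<close> comes from an actual degree that it bounds, so a
    vertex and a colour must exist; the empty cases are treated separately.\<close>
  have "d \<ge> 0" using assms(7) False by (meson all_not_in_conv of_nat_0_le_iff order_trans)
  then have d': "real d' \<le> d" unfolding d'_def by simp
  have "card ?H \<le> card V * (card J * d') * (16 * (card J)\<^sup>2 * Q) ^ 3"
    using assms(7) \<open>d \<ge> 0\<close> unfolding d'_def
    by (intro card_K5_le[OF assms(1-3,6)]) (simp_all add: le_nat_iff le_floor_iff)
  then have "real (card ?H) \<le> real (card V * (card J * d') * (16 * (card J)\<^sup>2 * Q) ^ 3)"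
    unfolding of_nat_le_iff .
  also have "\<dots> = real (card V) * (real (card J) * real d' * (16 * (real (card J))\<^sup>2 * real Q) ^ 3)"
    by simp
  also have "\<dots> \<le> real (card V) * (real (card J) * d * (16 * (real (card J))\<^sup>2 * real Q) ^ 3)"
    using d' by (intro mult_left_mono mult_right_mono) auto
  finally have "2 * real (card ?H) \<le> real (card V) * (2 * (real (card J) * d * (16 * (real (card J))\<^sup>2 * real Q) ^ 3))"
    by simp
  also have "\<dots> \<le> real (card V) * y ^ 4" using y by (intro mult_left_mono) auto
  finally have "2 * real (card ?H) \<le> y ^ (5 - 1) * real (card V)" by (simp add: mult.commute)
  then obtain X where X: "X \<subseteq> V" "\<forall>e\<in>?H. \<not> e \<subseteq> X" "real (card V) \<le> 4 * y * real (card X)"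
    using hypergraph_independent_set[OF assms(2) _ assms(5), of ?H 5] by auto
  have "K_free 5 X E"
    unfolding K_free_def
  proof (rule notI, elim bexE)
    fix e assume "e \<in> [X]\<^bsup>5\<^esup>" "clique e E"
    then have "e \<in> ?H" "e \<subseteq> X" using X(1) by (auto simp: nsets_def)
    then show False using X(2) by blast
  qed
  then have "real (card X) \<le> real m" using K_free_boundD[OF assms(4) X(1)] by simp
  then have "4 * y * real (card X) \<le> 4 * y * real m"
    using assms(5) by (intro mult_left_mono) auto
  with X(3) show ?thesis by simp
next
  case True
  then show ?thesis
  proof
    assume "V = {}" then show ?thesis using assms(5) by simp
  next
    assume "J = {}"
    then have "K_free 2 V E"
      using triangle_colouring_mem[OF assms(1)] by (auto simp: K_free_2_iff)
    then have "card V \<le> m"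
      by (rule K_free_boundD[OF assms(4) subset_refl K_free_mono]) simp
    then show ?thesis using assms(5) mult_right_mono[of 1 "4 * y" "real m"] by simp
  qed
qed

section \<open>Triangles with two edges outside a fixed colour\<close>

text \<open>\<open>P\<close> lists the ordered pairs starting in \<open>U\<close> whose edge avoids
  colour \<open>i\<close>. The hypergraph \<open>H\<close> consists of triples in \<open>U\<close>
  extending such a pair by a vertex that sees two colours towards it; a set independent in
  \<open>H\<close> meets the cherry condition and is therefore \<open>K_5\<close>-free.\<close>

lemma card_le_of_few_cherries:
  assumes "triangle_colouring J V E c" "finite V" "finite J" "U \<subseteq> V" "i \<in> J" "K_free_bound 5 V E m" "y \<ge> 1"
    and "\<And>a b i j. a \<in> V \<Longrightarrow> b \<in> V \<Longrightarrow> i \<in> J \<Longrightarrow> j \<in> J \<Longrightarrow> i \<noteq> j \<Longrightarrow>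
       card (V \<inter> colour_nbhd E c i a \<inter> colour_nbhd E c j b) \<le> Q"
    and P: "P = Sigma U (\<lambda>u. \<Union>j\<in>J - {i}. V \<inter> colour_nbhd E c j u)"
    and y: "2 * (real (card P) * (16 * (real (card J))\<^sup>2 * real Q)) \<le> y ^ 2 * real (card U)"
  shows "real (card U) \<le> 4 * y * real m"
proof -
  let ?X = "two_coloured_extensions V E c J" and ?L = "16 * (card J)\<^sup>2 * Q"
  define H where "H = (\<Union>p\<in>P. \<Union>x\<in>?X {fst p, snd p}. {{fst p, snd p, x}}) \<inter> [U]\<^bsup>3\<^esup>"
  have finU: "finite U" using assms(2,4) finite_subset by blast
  have finP: "finite P" unfolding P using assms(2,3) finU by (intro finite_SigmaI) auto
  have sub: "(\<Union>p\<in>P. \<Union>x\<in>?X {fst p, snd p}. {{fst p, snd p, x}}) \<inter> [U]\<^bsup>3\<^esup> \<subseteq> (\<Union>p\<in>P. \<Union>x\<in>?X {fst p, snd p}. {{fst p, snd p, x}})"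
    by (rule Int_lower1)
  have "card H \<le> card (\<Union>p\<in>P. \<Union>x\<in>?X {fst p, snd p}. {{fst p, snd p, x}})"
    unfolding H_def using finP assms(2) by (intro card_mono sub finite_UN_I finite_two_coloured_extensions) auto
  also have "\<dots> \<le> card P * (?L * 1)"
  proof (intro card_UN_le_mult)
    fix p assume "p \<in> P"
    then have "{fst p, snd p} \<subseteq> V" using assms(4) unfolding P by auto
    then show "card (?X {fst p, snd p}) \<le> ?L"
      by (intro card_two_coloured_extensions[OF assms(2,3) _ _ _ assms(8)]) (auto simp: card_insert_if)
  qed (simp_all add: finP assms(2) finite_two_coloured_extensions)
  finally have "real (card H) \<le> real (card P * (?L * 1))" unfolding of_nat_le_iff .
  then have "2 * real (card H) \<le> y ^ (3 - 1) * real (card U)" using y by simp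
  then obtain X where X: "X \<subseteq> U" "\<forall>e\<in>H. \<not> e \<subseteq> X" "real (card U) \<le> 4 * y * real (card X)"
    using hypergraph_independent_set[OF finU _ assms(7), of H 3] unfolding H_def by auto
  have in_H: "{u, v, x} \<in> H"
    if "u \<in> X" "v \<in> X" "x \<in> X" "u \<noteq> v" "v \<noteq> x" "u \<noteq> x" "{u, v} \<in> E" "{v, x} \<in> E" "{u, x} \<in> E"
      "c {u, v} \<noteq> i" "c {x, u} \<noteq> c {x, v}" for u v x
  proof -
    have inV: "u \<in> V" "v \<in> V" "x \<in> V" and inU: "u \<in> U" "v \<in> U" "x \<in> U" using that X(1) assms(4) by auto
    have "c {u, v} \<in> J - {i}" using triangle_colouring_mem[OF assms(1) inV(1,2)] that by simp
    then have "(u, v) \<in> P" unfolding P using inV inU that by (auto simp: colour_nbhd_def)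
    moreover have "x \<in> ?X {u, v}"
      using that inV by (intro two_coloured_extensionsI[OF assms(1), of u _ v]) (auto simp: insert_commute)
    moreover have "{u, v, x} \<in> [U]\<^bsup>3\<^esup>" using inU that by (simp add: nsets_def)
    ultimately show ?thesis
      unfolding H_def by (intro IntI UN_I[of "(u, v)"] UN_I[of x]) simp_all
  qed
  have "K_free 5 X E"
  proof (rule K_free_5_of_no_cherry[OF assms(1)])
    show "X \<subseteq> V" using X(1) assms(4) by simp
    fix a b d
    assume X': "a \<in> X" "b \<in> X" "d \<in> X" "a \<noteq> b" "b \<noteq> d" "a \<noteq> d" and E: "{a, b} \<in> E" "{b, d} \<in> E" "{a, d} \<in> E"
    show "c {a, b} = i \<or> c {b, d} = i"
    proof (rule ccontr)
      assume "\<not> ?thesis"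
      then have ne: "c {a, b} \<noteq> i" "c {b, d} \<noteq> i" by auto
      have sub: "{a, b, d} \<subseteq> X" "{b, d, a} \<subseteq> X" using X' by auto
      have eq: "{d, a} = {a, d}" "{d, b} = {b, d}" "{b, a} = {a, b}" by auto
      have "{a, b, d} \<notin> H" "{b, d, a} \<notin> H" using X(2) sub by auto
      \<comment> \<open>Neither triple extends its pair in two colours: \<open>d\<close> sees one
        colour on \<open>{a, b}\<close>, and \<open>a\<close> sees one colour on
        \<open>{b, d}\<close>. Hence the triangle would be monochromatic.\<close>
      then have "c {d, a} = c {d, b}" "c {a, b} = c {a, d}"
        using in_H[OF X'(1,2,3,4,5,6) E(1,2,3) ne(1)]
          in_H[OF X'(2,3,1) X'(5) X'(6)[symmetric] X'(4)[symmetric] E(2) _ _ ne(2)] E unfolding eq by blast+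
      then have "c {b, d} = c {a, b}" "c {a, d} = c {a, b}"
        unfolding eq by simp_all
      then show False
        using X' X(1) assms(4) E
        by (intro triangle_colouring_no_triangle[OF assms(1), of a b d "c {a, b}"]) auto
    qed
  qed
  then have "real (card X) \<le> real m"
    using K_free_boundD[OF assms(6), of X] X(1) assms(4) by simp
  then have "4 * y * real (card X) \<le> 4 * y * real m"
    using assms(7) by (intro mult_left_mono) auto
  with X(3) show ?thesis by simp
qed

text \<open>Double counting of triples \<open>(u, v, x)\<close> with \<open>(u, v)\<close> in
  \<open>P\<close> and \<open>x\<close> an \<open>i\<close>-neighbour of \<open>u\<close>. Each pair
  has at least \<open>d\<close> such \<open>x\<close>, while \<open>v\<close>, \<open>x\<close> and
  the colour \<open>j\<close> of \<open>{u, v}\<close> leave at most \<open>Q\<close> choices of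
  \<open>u\<close>.\<close>

lemma card_minor_colour_pairs:
  assumes "triangle_colouring J V E c" "finite V" "finite J" "U \<subseteq> V" "i \<in> J"
    and Q: "\<And>a b i j. a \<in> V \<Longrightarrow> b \<in> V \<Longrightarrow> i \<in> J \<Longrightarrow> j \<in> J \<Longrightarrow> i \<noteq> j \<Longrightarrow>
       card (V \<inter> colour_nbhd E c i a \<inter> colour_nbhd E c j b) \<le> Q"
    and P: "P = Sigma U (\<lambda>u. \<Union>j\<in>J - {i}. V \<inter> colour_nbhd E c j u)"
    and d: "\<And>u. u \<in> U \<Longrightarrow> d \<le> real (card (V \<inter> colour_nbhd E c i u))"
  shows "real (card P) * d \<le> real (card J) * (real (card V))\<^sup>2 * real Q"
proof -
  have finU: "finite U" using assms(2,4) finite_subset by blast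
  have finP: "finite P" unfolding P using assms(2,3) finU by (intro finite_SigmaI) auto
  define T where "T = Sigma P (\<lambda>p. V \<inter> colour_nbhd E c i (fst p))"
  have "real (card P) * d = (\<Sum>p\<in>P. d)" by simp
  also have "\<dots> \<le> (\<Sum>p\<in>P. real (card (V \<inter> colour_nbhd E c i (fst p))))"
    by (intro sum_mono d) (auto simp: P)
  also have "\<dots> = real (card T)"
    unfolding T_def using finP assms(2) by (subst card_SigmaI) auto
  also have "card T \<le> card V * (card V * (card J * Q))"
  proof -
    let ?B = "\<Union>v\<in>V. \<Union>x\<in>V. \<Union>j\<in>J - {i}. (\<lambda>u. ((u, v), x)) ` (V \<inter> colour_nbhd E c i x \<inter> colour_nbhd E c j v)"
    have "T \<subseteq> ?B"
    proof
      fix t assume "t \<in> T"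
      then obtain u v x where t: "t = ((u, v), x)" "(u, v) \<in> P" "x \<in> V \<inter> colour_nbhd E c i u"
        unfolding T_def by auto
      then obtain j where j: "u \<in> U" "j \<in> J - {i}" "v \<in> V \<inter> colour_nbhd E c j u" unfolding P by auto
      then have "u \<in> V \<inter> colour_nbhd E c i x \<inter> colour_nbhd E c j v"
        using t(3) assms(4) by (auto simp: colour_nbhd_def insert_commute)
      then show "t \<in> ?B" using t j by blast
    qed
    moreover have "finite ?B" using assms(2,3) by auto
    ultimately have "card T \<le> card ?B" by (rule card_mono[rotated])
    also have "\<dots> \<le> card V * (card V * (card J * Q))"
    proof (intro card_UN_le_mult)
      show "card (J - {i}) \<le> card J" using assms(3) by (intro card_mono) auto
      fix v x j assume "v \<in> V" "x \<in> V" "j \<in> J - {i}"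
      then have "card (V \<inter> colour_nbhd E c i x \<inter> colour_nbhd E c j v) \<le> Q"
        using assms(5) by (intro Q) auto
      then show "card ((\<lambda>u. ((u, v), x)) ` (V \<inter> colour_nbhd E c i x \<inter> colour_nbhd E c j v)) \<le> Q"
        using assms(2) by (intro order_trans[OF card_image_le]) auto
    qed (use assms(2,3) in simp_all)
    finally show ?thesis .
  qed
  finally have "real (card P) * d \<le> real (card V * (card V * (card J * Q)))" by simp
  then show ?thesis by (simp add: power2_eq_square mult_ac)
qed

section \<open>The exponents for three and four colours\<close>

lemma powr_mult_power:
  fixes x :: real
  assumes "x > 0"
  shows "x powr a * x ^ k = x powr (a + real k)"
  using assms by (simp add: powr_add powr_realpow)

lemma ramsey_triangle_1_le: "ramsey_triangle 1 \<le> 3"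
proof -
  have "partn_lst {..<3::nat} (replicate 1 3) 2"
    unfolding partn_lst_def length_replicate
  proof (intro ballI exI conjI)
    fix f :: "nat set \<Rightarrow> nat" assume f: "f \<in> [{..<3}]\<^bsup>2\<^esup> \<rightarrow> {..<1}"
    have "{..<3::nat} \<in> nsets {..<3} (replicate 1 3 ! 0)" by (simp add: nsets_def)
    moreover have "f ` [{..<3}]\<^bsup>2\<^esup> \<subseteq> {0}" using f by auto
    ultimately show "monochromatic {..<3} (replicate 1 3 ! 0) 2 f 0" unfolding monochromatic_def by blast
  qed simp
  then show ?thesis by (simp only: partn_lst_ramsey_triangle_iff)
qed

text \<open>With threshold \<open>m powr \<delta>\<close> the low-degree case yields the exponent
  \<open>(\<delta> + 7) / 4\<close> and the high-degree case \<open>4 - \<delta>\<close>. These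
  agree at \<open>\<delta> = 9/5\<close>, where both equal \<open>11/5\<close>.\<close>

lemma three_colour_lower_bound:
  assumes col: "triangle_colouring J V E c" and "finite V" "finite J" "card J = 3" and bd: "K_free_bound 5 V E m"
  shows "real (card V) \<le> 1000000 * real m powr (11/5)"
proof (cases "V = {}")
  case False
  have m: "real m \<ge> 1"
    using card_pos_of_K_free_bound[OF bd \<open>finite V\<close> False] by simp
  have Q: "card (V \<inter> colour_nbhd E c i a \<inter> colour_nbhd E c j b) \<le> m"
    if "a \<in> V" "b \<in> V" "i \<in> J" "j \<in> J" "i \<noteq> j" for a b i j
  proof (rule K_free_boundD[OF bd])
    have "card (J - {i} - {j}) = 1" using that assms(3,4) by simp
    then show "K_free 5 (V \<inter> colour_nbhd E c i a \<inter> colour_nbhd E c j b) E"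
      using ramsey_triangle_1_le assms(3)
      by (intro K_free_of_ramsey_triangle[OF triangle_colouring_two_nbhds[OF col that(1,2)]]) auto
  qed auto
  define d where "d = real m powr (9/5)"
  define U where "U = (\<lambda>i. {u \<in> V. d \<le> real (card (V \<inter> colour_nbhd E c i u))})"
  define V0 where "V0 = {u \<in> V. \<forall>i\<in>J. real (card (V \<inter> colour_nbhd E c i u)) \<le> d}"
  have sub: "V0 \<subseteq> V" "U i \<subseteq> V" for i by (auto simp: V0_def U_def)
  have "V \<subseteq> V0 \<union> (\<Union>i\<in>J. U i)" by (auto simp: V0_def U_def)
  then have "card V \<le> card (V0 \<union> (\<Union>i\<in>J. U i))"
    using assms(2,3) finite_subset[OF sub(1)] finite_subset[OF sub(2)] by (intro card_mono) auto
  also have "\<dots> \<le> card V0 + card (\<Union>i\<in>J. U i)" by (rule card_Un_le)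
  also have "card (\<Union>i\<in>J. U i) \<le> (\<Sum>i\<in>J. card (U i))" by (rule card_UN_le[OF assms(3)])
  finally have n_le: "card V \<le> card V0 + (\<Sum>i\<in>J. card (U i))" by simp
  \<comment> \<open>Pigeonhole over the low-degree set and the three sets of high degree in one
    colour.\<close>
  have "card V \<le> 4 * card V0 \<or> (\<exists>i\<in>J. card V \<le> 4 * card (U i))"
  proof (rule ccontr)
    assume "\<not> ?thesis"
    then have "4 * card V0 < card V" and "\<forall>i\<in>J. 4 * card (U i) < card V" by auto
    then have "(\<Sum>i\<in>J. 4 * card (U i)) \<le> card J * card V"
      using sum_bounded_above[of J "\<lambda>i. 4 * card (U i)" "card V"] by (simp add: less_imp_le)
    then have "4 * (\<Sum>i\<in>J. card (U i)) \<le> 3 * card V" by (simp add: sum_distrib_left assms(4))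
    with n_le \<open>4 * card V0 < card V\<close> show False by simp
  qed
  then show ?thesis
  proof
    assume V0: "card V \<le> 4 * card V0"
    \<comment> \<open>The constant satisfies \<open>2 * 3 * 144 ^ 3 \<le> 70 ^ 4\<close>, where
      \<open>144 = 16 * 3\<^sup>2\<close>.\<close>
    define y where "y = 70 * real m powr (6/5)"
    have "real (card V0) \<le> 4 * y * real m"
    proof (rule card_le_of_few_K5[OF triangle_colouring_subset[OF col sub(1)] _ assms(3) K_free_bound_subset[OF bd sub(1)]])
      show "finite V0" using finite_subset[OF sub(1) assms(2)] .
      show "1 \<le> y" using m ge_one_powr_ge_zero[of "real m" "6/5"] by (simp add: y_def)
      show "card (V0 \<inter> colour_nbhd E c i a \<inter> colour_nbhd E c j b) \<le> m"
        if "a \<in> V0" "b \<in> V0" "i \<in> J" "j \<in> J" "i \<noteq> j" for a b i j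
        using sub(1) that assms(2) by (intro order_trans[OF card_mono Q[of a b i j]]) auto
      show "real (card (V0 \<inter> colour_nbhd E c i a)) \<le> d" if "a \<in> V0" "i \<in> J" for a i
      proof -
        have "card (V0 \<inter> colour_nbhd E c i a) \<le> card (V \<inter> colour_nbhd E c i a)"
          using sub(1) assms(2) by (intro card_mono) auto
        moreover have "real (card (V \<inter> colour_nbhd E c i a)) \<le> d" using that by (simp add: V0_def)
        ultimately show ?thesis by linarith
      qed
      have "d * real m ^ 3 = real m powr (24/5)"
        using m powr_mult_power[of "real m" "9/5" 3] by (simp add: d_def)
      moreover have "y ^ 4 = 24010000 * real m powr (24/5)"
        using m by (simp add: y_def power_mult_distrib powr_power)
      ultimately show "2 * (real (card J) * d * (16 * (real (card J))\<^sup>2 * real m) ^ 3) \<le> y ^ 4"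
        by (simp add: assms(4) power_mult_distrib)
    qed
    moreover have "4 * y * real m = 280 * real m powr (11/5)"
      using m powr_mult_power[of "real m" "6/5" 1] by (simp add: y_def)
    ultimately have "real (card V) \<le> 1120 * real m powr (11/5)" using V0 by linarith
    then show ?thesis
      using powr_ge_zero[of "real m" "11/5"] by linarith
  next
    assume "\<exists>i\<in>J. card V \<le> 4 * card (U i)"
    then obtain i where i: "i \<in> J" "card V \<le> 4 * card (U i)" by blast
    define n where "n = real (card V)"
    have n: "n \<ge> 1" using False assms(2) by (simp add: n_def Suc_le_eq card_gt_0_iff)
    define P where "P = Sigma (U i) (\<lambda>u. \<Union>j\<in>J - {i}. V \<inter> colour_nbhd E c j u)"
    \<comment> \<open>Here \<open>3456 = 4 * 2 * 144 * 3\<close>: the 4 from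
      \<open>card (U i) \<ge> n / 4\<close>, the 3 from the bound on \<open>card P\<close>. Since
      \<open>y\<close> contains the square root of \<open>n\<close>, the final inequality is squared
      and divided by \<open>n\<close>.\<close>
    define y where "y = sqrt (3456 * n * real m powr (1/5))"
    have m15: "real m powr (1/5) \<ge> 1" using m by (simp add: ge_one_powr_ge_zero)
    have y2: "y\<^sup>2 = 3456 * n * real m powr (1/5)" using n by (simp add: y_def)
    have "real (card P) * d \<le> real (card J) * (real (card V))\<^sup>2 * real m"
      by (rule card_minor_colour_pairs[OF col assms(2,3) sub(2) i(1) Q P_def]) (auto simp: U_def)
    then have Pd: "real (card P) * d \<le> 3 * n\<^sup>2 * real m" by (simp add: assms(4) n_def)
    have "real (card (U i)) \<le> 4 * y * real m"
    proof (rule card_le_of_few_cherries[OF col assms(2,3) sub(2) i(1) bd _ Q P_def])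
      have "1 * 1 \<le> (3456 * n) * real m powr (1/5)" using n m15 by (intro mult_mono) auto
      then show "1 \<le> y" by (simp add: y_def)
      have "real m powr (4/5) * (real (card P) * real m) = real (card P) * d"
        using m powr_mult_power[of "real m" "4/5" 1] by (simp add: d_def)
      also have "\<dots> \<le> real m powr (4/5) * (3 * n\<^sup>2 * real m powr (1/5))"
        using Pd m by (simp add: powr_add[symmetric] mult_ac)
      finally have "real (card P) * real m \<le> 3 * n\<^sup>2 * real m powr (1/5)"
        using m by (subst (asm) mult_le_cancel_left_pos) simp_all
      then have "2 * (real (card P) * (16 * (real (card J))\<^sup>2 * real m)) \<le> y\<^sup>2 * (n / 4)"
        unfolding y2 assms(4) by (simp add: power2_eq_square algebra_simps)
      also have "\<dots> \<le> y\<^sup>2 * real (card (U i))"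
        using i(2) by (intro mult_left_mono) (auto simp: n_def)
      finally show "2 * (real (card P) * (16 * (real (card J))\<^sup>2 * real m)) \<le> y\<^sup>2 * real (card (U i))" .
    qed
    then have "n \<le> 16 * y * real m" using i(2) unfolding n_def by simp
    then have "n\<^sup>2 \<le> (16 * y * real m)\<^sup>2" using n by (intro power_mono) auto
    also have "\<dots> = n * (884736 * (real m powr (1/5) * (real m)\<^sup>2))"
      by (simp add: power_mult_distrib y2)
    finally have "n * n \<le> n * (884736 * (real m powr (1/5) * (real m)\<^sup>2))" by (simp add: power2_eq_square)
    then have "n \<le> 884736 * (real m powr (1/5) * (real m)\<^sup>2)"
      using n by (subst (asm) mult_le_cancel_left_pos) simp_all
    also have "real m powr (1/5) * (real m)\<^sup>2 = real m powr (11/5)"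
      using m powr_mult_power[of "real m" "1/5" 2] by simp
    finally show ?thesis
      using powr_ge_zero[of "real m" "11/5"] unfolding n_def by linarith
  qed
qed simp

text \<open>Two colour neighbourhoods of different colours leave two colours, so their intersection
  is bounded by the square-root bound; one neighbourhood leaves three colours, so degrees are
  bounded by the three-colour result. Counting 5-cliques gives the exponent
  \<open>(11/5 + 6) / 4 + 1 = 61/20\<close>.\<close>

lemma four_colour_lower_bound:
  assumes col: "triangle_colouring J V E c" and "finite V" "finite J" "card J = 4" and bd: "K_free_bound 5 V E m"
  shows "real (card V) \<le> 32000 * real m powr (61/20)"
proof (cases "V = {}")
  case False
  have m: "real m \<ge> 1"
    using card_pos_of_K_free_bound[OF bd \<open>finite V\<close> False] by simp
  \<comment> \<open>The constant satisfies \<open>2 * 4 * 1000000 * 768 ^ 3 \<le> 8000 ^ 4\<close>,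
    where \<open>768 = 16 * 4\<^sup>2 * 3\<close>.\<close>
  define y where "y = 8000 * real m powr (41/20)"
  have "real (card V) \<le> 4 * y * real m"
  proof (rule card_le_of_few_K5[OF col assms(2,3) bd])
    show "1 \<le> y" using m ge_one_powr_ge_zero[of "real m" "41/20"] by (simp add: y_def)
    show "card (V \<inter> colour_nbhd E c i a \<inter> colour_nbhd E c j b) \<le> 3 * m\<^sup>2"
      if "a \<in> V" "b \<in> V" "i \<in> J" "j \<in> J" "i \<noteq> j" for a b i j
    proof -
      let ?W = "V \<inter> colour_nbhd E c i a \<inter> colour_nbhd E c j b"
      have J: "card (J - {i} - {j}) = 2" using that assms(3,4) by simp
      have "card ?W \<le> (card (J - {i} - {j}) + 1) * m\<^sup>2"
      proof (rule sqrt_lower_bound[OF triangle_colouring_two_nbhds[OF col that(1,2)]])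
        show "finite ?W" using assms(2) by simp
        show "K_free_bound 5 ?W E m" by (rule K_free_bound_subset[OF bd]) auto
        show "ramsey_triangle (card (J - {i} - {j}) - 1) \<le> 5" using ramsey_triangle_1_le unfolding J by simp
      qed (use assms(3) in simp_all)
      then show ?thesis unfolding J by simp
    qed
    show "real (card (V \<inter> colour_nbhd E c i a)) \<le> 1000000 * real m powr (11/5)" if "a \<in> V" "i \<in> J" for a i
    proof (rule three_colour_lower_bound[OF triangle_colouring_colour_nbhd[OF col that(1), of i]])
      show "K_free_bound 5 (V \<inter> colour_nbhd E c i a) E m" by (rule K_free_bound_subset[OF bd]) auto
    qed (use assms(2,3,4) that in simp_all)
    have "real m powr (11/5) * (real m ^ 2) ^ 3 = real m powr (41/5)"
      using m powr_mult_power[of "real m" "11/5" 6] by (simp flip: power_mult)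
    moreover have "y ^ 4 = 8000 ^ 4 * real m powr (41/5)"
      using m by (simp add: y_def power_mult_distrib powr_power)
    ultimately show "2 * (real (card J) * (1000000 * real m powr (11/5)) * (16 * (real (card J))\<^sup>2 * real (3 * m\<^sup>2)) ^ 3) \<le> y ^ 4"
      by (simp add: assms(4) power_mult_distrib)
  qed
  also have "4 * y * real m = 32000 * real m powr (61/20)"
    using m powr_mult_power[of "real m" "41/20" 1] by (simp add: y_def)
  finally show ?thesis .
qed simp

subsection \<open>The Erdos--Rogers function\<close>

text \<open>The error exponent is \<open>log (real n) (g n) - a\<close>; bounds for every fixed
  \<open>\<epsilon>\<close> say precisely that it is eventually small.\<close>

lemma power_o1I:
  assumes lower: "\<And>\<epsilon>. \<epsilon> > 0 \<Longrightarrow> \<forall>\<^sub>F n in sequentially. real n powr (a - \<epsilon>) \<le> g n"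
    and upper: "\<And>\<epsilon>. \<epsilon> > 0 \<Longrightarrow> \<forall>\<^sub>F n in sequentially. g n \<le> real n powr (a + \<epsilon>)"
  shows "g \<in> power_o1 a"
proof -
  define e where "e = (\<lambda>n. log (real n) (g n) - a)"
  have "e \<longlonglongrightarrow> 0"
  proof (rule tendstoI)
    fix \<epsilon> :: real assume "\<epsilon> > 0"
    then have "\<epsilon> / 2 > 0" by simp
    from lower[OF this] upper[OF this] eventually_gt_at_top[of 1]
    show "\<forall>\<^sub>F n in sequentially. dist (e n) 0 < \<epsilon>"
    proof eventually_elim
      case (elim n)
      have n: "real n > 1" using elim(3) by simp
      have "g n > 0" using elim(1) n by (smt (verit) powr_gt_zero)
      then have "a - \<epsilon> / 2 \<le> log (real n) (g n)" "log (real n) (g n) \<le> a + \<epsilon> / 2"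
        using elim(1,2) n by (simp_all add: le_log_iff log_le_iff)
      then show ?case using \<open>\<epsilon> > 0\<close> unfolding e_def dist_real_def by linarith
    qed
  qed
  then have "e \<in> o(\<lambda>_. 1)" by (intro smalloI_tendsto) simp_all
  moreover have "\<forall>\<^sub>F n in sequentially. g n = real n powr (a + e n)"
    using lower[OF zero_less_one] eventually_gt_at_top[of 1]
  proof eventually_elim
    case (elim n)
    have n: "real n > 1" using elim(2) by simp
    have "g n > 0" using elim(1) n by (smt (verit) powr_gt_zero)
    then show ?case using n by (simp add: e_def)
  qed
  ultimately show ?thesis unfolding power_o1_def by blast
qed

lemma erdos_rogers_sqrt_upper:
  assumes "s \<ge> 2" "s < ramsey_triangle t" "\<epsilon> > 0"
  shows "\<forall>\<^sub>F n in sequentially. real (erdos_rogers s (replicate t 3) n) \<le> real n powr (1/2 + \<epsilon>)"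
proof -
  obtain chi where "triangle_colouring {..<t} {..<s} ([{..<s}]\<^bsup>2\<^esup>) chi"
    using iffD2[OF ex_triangle_colouring_iff assms(2)] by (rule exE)
  from sqrt_upper_bound[OF this assms(1,3)] show ?thesis
  proof eventually_elim
    case (elim n)
    then obtain E c m where "E \<subseteq> [{..<n}]\<^bsup>2\<^esup>" "triangle_colouring {..<t} {..<n} E c" "K_free_bound s {..<n} E m"
      and m: "real m \<le> real n powr (1/2 + \<epsilon>)" by (elim exE conjE)
    then have "erdos_rogers s (replicate t 3) n \<le> m" using assms(1) by (intro erdos_rogers_le) auto
    then show ?case using m by linarith
  qed
qed

lemma erdos_rogers_sqrt_lower:
  assumes "s \<ge> 2" "ramsey_triangle (t - 1) \<le> s" "\<epsilon> > 0"
  shows "\<forall>\<^sub>F n in sequentially. real n powr (1/2 - \<epsilon>) \<le> real (erdos_rogers s (replicate t 3) n)"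
proof -
  have "\<forall>\<^sub>F n::nat in sequentially. sqrt (real (t + 1)) * real n powr (1/2 - \<epsilon>) \<le> real n powr (1/2)"
    using \<open>\<epsilon> > 0\<close> by real_asymp
  then show ?thesis
  proof eventually_elim
    case (elim n)
    let ?m = "erdos_rogers s (replicate t 3) n"
    obtain E c where "triangle_colouring {..<t} {..<n} E c" "K_free_bound s {..<n} E ?m"
      using erdos_rogers_attained[of n t s] by (elim exE conjE)
    then have "card {..<n} \<le> (card {..<t} + 1) * ?m\<^sup>2"
      using assms(1,2) by (intro sqrt_lower_bound) simp_all
    then have "n \<le> (t + 1) * ?m\<^sup>2" by simp
    then have "real n \<le> real ((t + 1) * ?m\<^sup>2)" unfolding of_nat_le_iff .
    then have "sqrt (real n) \<le> sqrt (real (t + 1) * (real ?m)\<^sup>2)"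
      by (simp only: of_nat_mult of_nat_power real_sqrt_le_iff)
    also have "\<dots> = sqrt (real (t + 1)) * real ?m" by (simp add: real_sqrt_mult)
    finally have "real n powr (1/2) \<le> sqrt (real (t + 1)) * real ?m" by (simp add: powr_half_sqrt)
    with elim have "sqrt (real (t + 1)) * real n powr (1/2 - \<epsilon>) \<le> sqrt (real (t + 1)) * real ?m"
      by (rule order_trans)
    then show ?case by (subst (asm) mult_le_cancel_left_pos) simp_all
  qed
qed

lemma erdos_rogers_sqrt:
  assumes "s \<ge> 2" "ramsey_triangle (t - 1) \<le> s" "s < ramsey_triangle t"
  shows "(\<lambda>n. real (erdos_rogers s (replicate t 3) n)) \<in> power_o1 (1/2)"
  by (intro power_o1I erdos_rogers_sqrt_upper erdos_rogers_sqrt_lower assms)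

lemma ramsey_triangle_2_gt: "5 < ramsey_triangle 2"
proof -
  \<comment> \<open>the pentagon and its complement\<close>
  define c :: "nat set \<Rightarrow> nat" where "c = (\<lambda>e. if e \<in> {{0, 1}, {1, 2}, {2, 3}, {3, 4}, {0, 4}} then 0 else 1)"
  have five: "{..<5} = {0, 1, 2, 3, 4::nat}" by auto
  have "triangle_colouring {..<2} {..<5} ([{..<5}]\<^bsup>2\<^esup>) c"
  proof (rule triangle_colouringI)
    show "c {x, y} \<in> {..<2}" for x y by (simp add: c_def)
    fix x y z j
    assume "x \<in> {..<5::nat}" "y \<in> {..<5::nat}" "z \<in> {..<5::nat}" "x \<noteq> y" "y \<noteq> z" "x \<noteq> z"
      and "c {x, y} = j" "c {y, z} = j" "c {x, z} = j"
    moreover from this have "c {x, y} = c {x, z}" "c {y, z} = c {x, z}" by simp_all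
    ultimately show False
      unfolding five by (elim insertE emptyE; simp add: c_def doubleton_eq_iff)
  qed
  then show ?thesis by (intro iffD1[OF ex_triangle_colouring_iff] exI)
qed

lemma powr_le_of_le_powr:
  fixes C x y p :: real
  assumes "C > 0" "p > 0" "x \<ge> 0" "y \<ge> 0" "x \<le> C * y powr p"
  shows "(1 / C) powr (1 / p) * x powr (1 / p) \<le> y"
proof -
  have "(1 / C) powr (1 / p) * x powr (1 / p) = (x / C) powr (1 / p)"
    using assms by (simp add: powr_mult[symmetric])
  also have "\<dots> \<le> (y powr p) powr (1 / p)"
    using assms by (intro powr_mono2) (simp_all add: field_simps)
  also have "\<dots> = y" using assms by (simp add: powr_powr)
  finally show ?thesis .
qed

lemma bigomega_of_le_powr:
  fixes f :: "nat \<Rightarrow> nat"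
  assumes "C > 0" "p > 0" "\<And>n. real n \<le> C * real (f n) powr p"
  shows "(\<lambda>n. real (f n)) \<in> \<Omega>(\<lambda>n. real n powr (1 / p))"
proof (rule landau_omega.bigI)
  show "(1 / C) powr (1 / p) > 0" using assms(1) by simp
  show "\<forall>\<^sub>F n in sequentially. norm (real (f n)) \<ge> (1 / C) powr (1 / p) * norm (real n powr (1 / p))"
    using powr_le_of_le_powr[OF assms(1,2) _ _ assms(3)] by (intro always_eventually) simp
qed

lemma erdos_rogers_three_colours_lower:
  "(\<lambda>n. real (erdos_rogers 5 (replicate 3 3) n)) \<in> \<Omega>(\<lambda>n. real n powr (5/11))"
proof -
  have "real n \<le> 1000000 * real (erdos_rogers 5 (replicate 3 3) n) powr (11/5)" for n
  proof -
    obtain E c where "triangle_colouring {..<3} {..<n} E c" "K_free_bound 5 {..<n} E (erdos_rogers 5 (replicate 3 3) n)"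
      using erdos_rogers_attained[of n 3 5] by (elim exE conjE)
    then have "real (card {..<n}) \<le> 1000000 * real (erdos_rogers 5 (replicate 3 3) n) powr (11/5)"
      by (intro three_colour_lower_bound[OF _ finite_lessThan finite_lessThan card_lessThan])
    then show ?thesis by simp
  qed
  from bigomega_of_le_powr[OF _ _ this] show ?thesis by simp
qed

lemma erdos_rogers_four_colours_lower:
  "(\<lambda>n. real (erdos_rogers 5 (replicate 4 3) n)) \<in> \<Omega>(\<lambda>n. real n powr (20/61))"
proof -
  have "real n \<le> 32000 * real (erdos_rogers 5 (replicate 4 3) n) powr (61/20)" for n
  proof -
    obtain E c where "triangle_colouring {..<4} {..<n} E c" "K_free_bound 5 {..<n} E (erdos_rogers 5 (replicate 4 3) n)"
      using erdos_rogers_attained[of n 4 5] by (elim exE conjE)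
    then have "real (card {..<n}) \<le> 32000 * real (erdos_rogers 5 (replicate 4 3) n) powr (61/20)"
      by (intro four_colour_lower_bound[OF _ finite_lessThan finite_lessThan card_lessThan])
    then show ?thesis by simp
  qed
  from bigomega_of_le_powr[OF _ _ this] show ?thesis by simp
qed

text \<open>A colouring with \<open>t\<close> colours is also one with \<open>u\<close> colours, so
  the minimum is taken over more graphs.\<close>

lemma erdos_rogers_more_colours:
  assumes "t \<le> u" "s > 0"
  shows "erdos_rogers s (replicate u 3) n \<le> erdos_rogers s (replicate t 3) n"
proof -
  obtain E c where E: "E \<subseteq> [{..<n}]\<^bsup>2\<^esup>" "triangle_colouring {..<t} {..<n} E c"
    "K_free_bound s {..<n} E (erdos_rogers s (replicate t 3) n)"
    using erdos_rogers_attained[of n t s] by (elim exE conjE)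
  have "triangle_colouring {..<u} {..<n} E c"
    using E(2) assms(1) unfolding triangle_colouring_def by force
  from erdos_rogers_le[OF E(1) this E(3) assms(2)] show ?thesis .
qed

text \<open>Four colours arise by doubling two, and 5 lies below the two-colour Ramsey
  number.\<close>

lemma erdos_rogers_cube_root_upper:
  assumes "\<epsilon> > 0"
  shows "\<forall>\<^sub>F n in sequentially. real (erdos_rogers 5 (replicate 4 3) n) \<le> real n powr (1/3 + \<epsilon>)"
proof -
  obtain chi where chi: "triangle_colouring {..<2} {..<5::nat} ([{..<5}]\<^bsup>2\<^esup>) chi"
    using iffD2[OF ex_triangle_colouring_iff ramsey_triangle_2_gt] by (rule exE)
  have "\<forall>\<^sub>F n in sequentially. \<exists>E c m. E \<subseteq> [{..<n}]\<^bsup>2\<^esup> \<and> triangle_colouring {..<2 + 2} {..<n} E c \<and>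
    K_free_bound 5 {..<n} E m \<and> real m \<le> real n powr (1/3 + \<epsilon>)"
    by (rule cube_root_upper_bound[OF sqrt_upper_bound[OF chi] assms]) simp_all
  then show ?thesis
  proof eventually_elim
    case (elim n)
    then obtain E c m where "E \<subseteq> [{..<n}]\<^bsup>2\<^esup>" "triangle_colouring {..<4} {..<n} E c" "K_free_bound 5 {..<n} E m"
      and m: "real m \<le> real n powr (1/3 + \<epsilon>)" by auto
    then have "erdos_rogers 5 (replicate 4 3) n \<le> m" by (intro erdos_rogers_le) auto
    then show ?case using m by linarith
  qed
qed

theorem corollary1p2:
  shows
    "(\<forall>t s :: nat. t \<ge> 1 \<and> s \<ge> 2 \<and> ramsey_triangle (t - 1) \<le> s \<and> s < ramsey_triangle t \<longrightarrow>
        (\<lambda>n. real (erdos_rogers s (replicate t 3) n)) \<in> power_o1 (1/2)) \<and>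
     (\<lambda>n. real (erdos_rogers 3 [3, 3] n)) \<in> power_o1 (1/2) \<and>
     (\<lambda>n. real (erdos_rogers 4 [3, 3] n)) \<in> power_o1 (1/2) \<and>
     (\<lambda>n. real (erdos_rogers 5 [3, 3] n)) \<in> power_o1 (1/2) \<and>
     (\<lambda>n. real (erdos_rogers 5 [3, 3, 3] n)) \<in> \<Omega>(\<lambda>n. real n powr (5/11)) \<and>
     (\<exists>g \<in> power_o1 (1/2). \<forall>\<^sub>F n in sequentially. real (erdos_rogers 5 [3, 3, 3] n) \<le> g n) \<and>
     (\<lambda>n. real (erdos_rogers 5 [3, 3, 3, 3] n)) \<in> \<Omega>(\<lambda>n. real n powr (20/61)) \<and>
     (\<exists>g \<in> power_o1 (1/3). \<forall>\<^sub>F n in sequentially. real (erdos_rogers 5 [3, 3, 3, 3] n) \<le> g n)"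
proof -
  have reps: "[3, 3] = replicate 2 (3::nat)" "[3, 3, 3] = replicate 3 (3::nat)" "[3, 3, 3, 3] = replicate 4 (3::nat)"
    by (simp_all add: eval_nat_numeral)
  have two: "(\<lambda>n. real (erdos_rogers s (replicate 2 3) n)) \<in> power_o1 (1/2)" if "3 \<le> s" "s \<le> 5" for s
  proof (rule erdos_rogers_sqrt)
    show "ramsey_triangle (2 - 1) \<le> s" using ramsey_triangle_1_le that(1) by simp
  qed (use that ramsey_triangle_2_gt in simp_all)
  have "\<forall>\<^sub>F n in sequentially. real (erdos_rogers 5 (replicate 3 3) n) \<le> real (erdos_rogers 5 (replicate 2 3) n)"
    by (intro always_eventually allI) (simp add: erdos_rogers_more_colours)
  then have three_upper: "\<exists>g \<in> power_o1 (1/2). \<forall>\<^sub>F n in sequentially. real (erdos_rogers 5 (replicate 3 3) n) \<le> g n"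
    using two[of 5] by (intro bexI) simp_all
  \<comment> \<open>The upper bound alone does not keep the exponent from dropping below
    \<open>1/3\<close>; the maximum with \<open>n powr (1/3)\<close> supplies the lower
    half.\<close>
  define g where "g = (\<lambda>n. max (real (erdos_rogers 5 (replicate 4 3) n)) (real n powr (1/3)))"
  have "g \<in> power_o1 (1/3)"
  proof (rule power_o1I)
    fix \<epsilon> :: real assume "\<epsilon> > 0"
    have low: "\<forall>\<^sub>F n::nat in sequentially. real n powr (1/3 - \<epsilon>) \<le> real n powr (1/3)"
      using \<open>\<epsilon> > 0\<close> by real_asymp
    then show "\<forall>\<^sub>F n in sequentially. real n powr (1/3 - \<epsilon>) \<le> g n"
      by eventually_elim (simp add: g_def)
    have up: "\<forall>\<^sub>F n::nat in sequentially. real n powr (1/3) \<le> real n powr (1/3 + \<epsilon>)"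
      using \<open>\<epsilon> > 0\<close> by real_asymp
    show "\<forall>\<^sub>F n in sequentially. g n \<le> real n powr (1/3 + \<epsilon>)"
      using up erdos_rogers_cube_root_upper[OF \<open>\<epsilon> > 0\<close>] by eventually_elim (simp add: g_def)
  qed
  moreover have "\<forall>\<^sub>F n in sequentially. real (erdos_rogers 5 (replicate 4 3) n) \<le> g n"
    by (intro always_eventually) (simp add: g_def)
  ultimately have four_upper: "\<exists>g \<in> power_o1 (1/3). \<forall>\<^sub>F n in sequentially. real (erdos_rogers 5 (replicate 4 3) n) \<le> g n"
    by (intro bexI[of _ g])
  show ?thesis
    unfolding reps(3) unfolding reps(2) unfolding reps(1)
    using erdos_rogers_sqrt two[of 3] two[of 4] two[of 5] three_upper four_upper
      erdos_rogers_three_colours_lower erdos_rogers_four_colours_lower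
    by (intro conjI allI impI) simp_all
qed

end
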